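(* Let $a>0$ be a real number and $k\ge 1$ an integer. Let $d=d(t)$ be an integer-valued function of $t$ with $d(t)\ge k$, and let $\psi(t)$ be a function with $\psi(t)\to\infty$ as $t\to\infty$. Then, with probability tending to $1$ as $t\to\infty$, the number $R(d,t)$ of nodes of degree $d=d(t)$ in the random graph $H_{a,k}^{(t)}$ satisfies $$ \left|R(d,t)-\frac{\mathrm{B}(d-k+ka,a+2)}{\mathrm{B}(ka,a+1)}\,t\right|\le \left(\sqrt{d^{-a-2}t}+d^{-1}\right)\psi(t). $$
   Context: The Buckley--Osthus random graph. Fix a real number $a>0$ and an integer $k\ge1$ (constants). Graphs are undirected, and loops and multiple edges are allowed; a loop contributes $2$ to the degree of its node. First stage: the random graph $H_{a,1}^{(t)}$ has nodes $1,\dots,t$ and $t$ edges. $H_{a,1}^{(1)}$ is the graph with one node and one loop. For $t\ge2$, $H_{a,1}^{(t)}$ is obtained from $H_{a,1}^{(t-1)}$ by adding a new node $t$ and one new edge between $t$ and a random node $\gamma\in\{1,\dots,t\}$, where, conditionally on the graph $H_{a,1}^{(t-1)}$, $$\Pr(\gamma=s)=\frac{\deg_{t-1}(s)-1+a}{(a+1)t-1}\ \text{ for } 1\le s\le t-1,\qquad \Pr(\gamma=t)=\frac{a}{(a+1)t-1},$$ and $\deg_{t-1}(s)$ is the degree of $s$ in $H_{a,1}^{(t-1)}$. Second stage: $H_{a,k}^{(t)}$ is obtained from $H_{a,1}^{(kt)}$ by identifying the nodes $1,\dots,k$ into one node, the nodes $k+1,\dots,2k$ into a second node, and so on, which gives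 $t$ nodes; all $kt$ edges are kept (possibly becoming multiple edges and multiple loops). $R(d,t)$ is the number of nodes of degree $d$ in $H_{a,k}^{(t)}$. $\mathrm{B}(x,y)=\Gamma(x)\Gamma(y)/\Gamma(x+y)$ is Euler's Beta function. *)

theory Defs
  imports "HOL-Probability.Probability" "HOL-Library.Uprod"
begin

datatype 'v multigraph =
  Multigraph (nodes: "'v set") (edges: "'v uprod multiset")

text \<open>
  Multiple edges are multiset multiplicities, and \<open>Upair v v\<close> is a loop at \<open>v\<close>.
  A loop is counted by both summands, so it contributes 2.
\<close>

definition deg :: "'v multigraph \<Rightarrow> 'v \<Rightarrow> nat" where
  "deg G v = size {#e \<in># edges G. v \<in> set_uprod e#} + count (edges G) (Upair v v)"

definition identify_nodes :: "('v \<Rightarrow> 'w) \<Rightarrow> 'v multigraph \<Rightarrow> 'w multigraph" where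
  "identify_nodes f G = Multigraph (f ` nodes G) (image_mset (map_uprod f) (edges G))"

definition attach_weight :: "real \<Rightarrow> nat \<Rightarrow> nat multigraph \<Rightarrow> nat \<Rightarrow> real" where
  "attach_weight a t G s =
     (if 1 \<le> s \<and> s \<le> t - 1 then (real (deg G s) - 1 + a) / ((a + 1) * real t - 1)
      else if s = t then a / ((a + 1) * real t - 1)
      else 0)"

text \<open>
  \<open>embed_pmf\<close> is only meaningful if the weights are nonnegative and sum to 1. This holds for every
  graph the process can reach, see \<open>pmf_attach_target\<close> below.
\<close>

definition attach_target :: "real \<Rightarrow> nat \<Rightarrow> nat multigraph \<Rightarrow> nat pmf" where
  "attach_target a t G = embed_pmf (attach_weight a t G)"

definition add_node_edge :: "nat \<Rightarrow> nat \<Rightarrow> nat multigraph \<Rightarrow> nat multigraph" where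
  "add_node_edge t s G = Multigraph (insert t (nodes G)) (add_mset (Upair t s) (edges G))"

text \<open>The process starts at \<open>t = 1\<close>; the value at \<open>0\<close> is a dummy.\<close>

fun BO1 :: "real \<Rightarrow> nat \<Rightarrow> nat multigraph pmf" where
  "BO1 a 0 = return_pmf (Multigraph {} {#})"
| "BO1 a (Suc 0) = return_pmf (Multigraph {1} {#Upair 1 1#})"
| "BO1 a (Suc (Suc n)) =
     bind_pmf (BO1 a (Suc n)) (\<lambda>G.
       map_pmf (\<lambda>s. add_node_edge (Suc (Suc n)) s G) (attach_target a (Suc (Suc n)) G))"

text \<open>The nodes \<open>(j - 1) * k + 1, \<dots>, j * k\<close> of the first-stage graph become the node \<open>j\<close>.\<close>

definition BO :: "real \<Rightarrow> nat \<Rightarrow> nat \<Rightarrow> nat multigraph pmf" where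
  "BO a k t = map_pmf (identify_nodes (\<lambda>v. (v - 1) div k + 1)) (BO1 a (k * t))"

definition num_nodes_of_degree :: "nat \<Rightarrow> 'v multigraph \<Rightarrow> nat" where
  "num_nodes_of_degree d G = card {v \<in> nodes G. deg G v = d}"


definition reachable :: "nat \<Rightarrow> nat multigraph \<Rightarrow> bool" where
  "reachable n G \<longleftrightarrow> nodes G = {1..n} \<and> size (edges G) = n \<and>
     (\<forall>v. deg G v > 0 \<longleftrightarrow> v \<in> {1..n}) \<and> (\<Sum>v=1..n. deg G v) = 2 * n"

lemma deg_add_node_edge:
  "deg (add_node_edge t s G) v = deg G v + of_bool (v = t) + of_bool (v = s)"
  by (auto simp: deg_def add_node_edge_def)

lemma attach_weight_nonneg:
  assumes "a > 0" "n \<ge> 1" "reachable n G"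
  shows "attach_weight a (Suc n) G s \<ge> 0"
proof -
  have "(a + 1) * real (Suc n) - 1 \<ge> 0"
    using assms by (simp add: algebra_simps)
  moreover have "real (deg G s) - 1 + a \<ge> 0" if "1 \<le> s" "s \<le> n"
  proof -
    have "deg G s > 0" using assms(3) that by (simp add: reachable_def)
    thus ?thesis using assms(1) by linarith
  qed
  ultimately show ?thesis
    using assms(1) by (simp add: attach_weight_def)
qed

lemma attach_weight_sum:
  assumes "a > 0" "n \<ge> 1" "reachable n G"
  shows "(\<Sum>s=1..Suc n. attach_weight a (Suc n) G s) = 1"
proof -
  define D where "D = (a + 1) * real (Suc n) - 1"
  have D: "D > 0"
  proof -
    have "D = a * real n + a + real n" by (simp add: D_def algebra_simps)
    thus ?thesis using assms(1,2) by (simp add: add_pos_nonneg)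
  qed
  have "(\<Sum>s=1..Suc n. attach_weight a (Suc n) G s)
      = (\<Sum>s=1..n. (real (deg G s) - 1 + a) / D) + a / D"
    by (simp add: attach_weight_def D_def)
  also have "\<dots> = ((\<Sum>s=1..n. real (deg G s) - 1 + a) + a) / D"
    by (simp add: sum_divide_distrib add_divide_distrib)
  also have "(\<Sum>s=1..n. real (deg G s) - 1 + a) = real (\<Sum>s=1..n. deg G s) + real n * (a - 1)"
    by (simp add: sum.distrib sum_subtractf algebra_simps)
  also have "(\<Sum>s=1..n. deg G s) = 2 * n"
    using assms(3) by (simp add: reachable_def)
  also have "(real (2 * n) + real n * (a - 1) + a) / D = D / D"
    by (simp add: D_def algebra_simps)
  finally show ?thesis using D by simp
qed

lemma pmf_attach_target_aux:
  assumes "a > 0" "n \<ge> 1" "reachable n G"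
  shows "pmf (attach_target a (Suc n) G) s = attach_weight a (Suc n) G s"
  unfolding attach_target_def
proof (rule pmf_embed_pmf)
  show "0 \<le> attach_weight a (Suc n) G x" for x
    using attach_weight_nonneg[OF assms] .
  have "(\<integral>\<^sup>+x. ennreal (attach_weight a (Suc n) G x) \<partial>count_space UNIV)
      = (\<Sum>x=1..Suc n. ennreal (attach_weight a (Suc n) G x))"
    by (rule nn_integral_count_space') (auto simp: attach_weight_def)
  also have "\<dots> = ennreal (\<Sum>x=1..Suc n. attach_weight a (Suc n) G x)"
    by (rule sum_ennreal) (use attach_weight_nonneg[OF assms] in auto)
  also have "\<dots> = 1"
    by (simp only: attach_weight_sum[OF assms] ennreal_1)
  finally show "(\<integral>\<^sup>+x. ennreal (attach_weight a (Suc n) G x) \<partial>count_space UNIV) = 1" .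
qed

lemma reachable_add_node_edge:
  assumes "reachable n G" "s \<in> {1..Suc n}"
  shows "reachable (Suc n) (add_node_edge (Suc n) s G)"
proof -
  have pos: "0 < deg G v \<longleftrightarrow> v \<in> {1..n}" for v
    using assms(1) unfolding reachable_def by blast
  have 0: "deg G (Suc n) = 0"
    using pos[of "Suc n"] by simp
  have "(\<Sum>v=1..Suc n. deg (add_node_edge (Suc n) s G) v)
      = (\<Sum>v=1..Suc n. deg G v) + (\<Sum>v=1..Suc n. of_bool (v = Suc n)) +
        (\<Sum>v=1..Suc n. of_bool (v = s))"
    by (simp only: deg_add_node_edge sum.distrib)
  also have "(\<Sum>v=1..Suc n. of_bool (v = Suc n)) = (1 :: nat)"
    by (simp add: of_bool_def sum.delta)
  also have "(\<Sum>v=1..Suc n. of_bool (v = s)) = (1 :: nat)"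
    unfolding of_bool_def using assms(2) by (subst sum.delta) auto
  also have "(\<Sum>v=1..Suc n. deg G v) = 2 * n"
    using assms(1) 0 by (simp add: reachable_def)
  finally have sum: "(\<Sum>v=1..Suc n. deg (add_node_edge (Suc n) s G) v) = 2 * Suc n"
    by simp
  have "deg (add_node_edge (Suc n) s G) v > 0 \<longleftrightarrow> v \<in> {1..Suc n}" for v
    using pos[of v] assms(2) by (auto simp: deg_add_node_edge le_Suc_eq)
  moreover have "nodes (add_node_edge (Suc n) s G) = {1..Suc n}"
    using assms(1) by (auto simp: reachable_def add_node_edge_def)
  moreover have "size (edges (add_node_edge (Suc n) s G)) = Suc n"
    using assms(1) by (simp add: reachable_def add_node_edge_def)
  ultimately show ?thesis
    using sum unfolding reachable_def by blast
qed

lemma reachable_BO1: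
  assumes "a > 0" "G \<in> set_pmf (BO1 a n)" "n \<ge> 1"
  shows "reachable n G"
  using assms
proof (induction a n arbitrary: G rule: BO1.induct)
  case (1 a)
  then show ?case by simp
next
  case (2 a)
  then show ?case by (auto simp: reachable_def deg_def)
next
  case (3 a n)
  then obtain H s where H: "H \<in> set_pmf (BO1 a (Suc n))"
    and s: "s \<in> set_pmf (attach_target a (Suc (Suc n)) H)"
    and G: "G = add_node_edge (Suc (Suc n)) s H"
    by auto
  have R: "reachable (Suc n) H"
    using 3 H by simp
  have "attach_weight a (Suc (Suc n)) H s \<noteq> 0"
    using s pmf_attach_target_aux[OF \<open>a > 0\<close> _ R, of s] by (simp add: set_pmf_iff)
  hence "s \<in> {1..Suc (Suc n)}"
    by (auto simp: attach_weight_def split: if_splits)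
  thus ?case
    using reachable_add_node_edge[OF R] G by simp
qed

lemma pmf_attach_target:
  assumes "a > 0" "t \<ge> 2" "G \<in> set_pmf (BO1 a (t - 1))"
  shows "pmf (attach_target a t G) s = attach_weight a t G s"
  using pmf_attach_target_aux[of a "t - 1" G s] reachable_BO1[of a G "t - 1"] assms by simp

end

theory Submission
  imports Defs
begin

text \<open>
  The variance of the number \<open>R\<close> of nodes of degree \<open>d\<close> is at most twice its mean. Given the graph after
  \<open>n\<close> steps, exactly one merged node receives the random end of the next edge, and node \<open>j\<close> receives it
  with a probability that depends only on its own degree. For exclusive events \<open>A_j\<close> the variance of
  \<open>\<Sum>j. \<Delta>_j 1(A_j)\<close> is at most \<open>2 (\<Sum>j. Var (\<Delta>_j 1(A_j)))\<close>. By induction on the number of steps, with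
  the law of total variance, \<open>Var (\<Sum>j. h_j(D_j)) \<le> 2 (\<Sum>j. Var (h_j(D_j)))\<close> for the degrees \<open>D_j\<close> of the
  merged nodes and all functions \<open>h_j\<close>. Indicator functions \<open>h_j\<close> give \<open>Var R \<le> 2 E R\<close>.

  The mean satisfies a linear recursion in \<open>d\<close> and the number of steps, which yields
  \<open>E R = c_d t + O(1 / d)\<close>, where \<open>c_d = O(d powr (- a - 2))\<close> is the quotient of Beta values. If
  \<open>1 / d \<le> x = d powr (- a - 2) * t\<close>, Chebyshev's inequality finishes the proof. Otherwise \<open>d\<close> tends to
  infinity and \<open>R = 0\<close> with high probability by Markov's inequality.
\<close>

subsection \<open>Expectation and variance for finitely supported mass functions\<close>

abbreviation expec :: "'a pmf \<Rightarrow> ('a \<Rightarrow> real) \<Rightarrow> real" where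
  "expec p h \<equiv> measure_pmf.expectation p h"

abbreviation vari :: "'a pmf \<Rightarrow> ('a \<Rightarrow> real) \<Rightarrow> real" where
  "vari p h \<equiv> measure_pmf.variance p h"

lemma expec_bind:
  assumes "finite (set_pmf p)" "\<And>x. x \<in> set_pmf p \<Longrightarrow> finite (set_pmf (K x))"
  shows "expec (bind_pmf p K) h = expec p (\<lambda>x. expec (K x) h)"
  using assms
  by (subst pmf_expectation_bind[of "set_pmf p"])
     (auto simp: integral_measure_pmf_real[of "set_pmf p"] mult.commute)

lemma expec_cong:
  assumes "\<And>x. x \<in> set_pmf p \<Longrightarrow> g x = h x"
  shows "expec p g = expec p h"
  by (rule integral_cong_AE) (auto simp: AE_measure_pmf_iff assms)

lemma expec_mono:
  assumes "finite (set_pmf p)" "\<And>x. x \<in> set_pmf p \<Longrightarrow> g x \<le> h x"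
  shows "expec p g \<le> expec p h"
  by (rule integral_mono_AE)
     (auto simp: AE_measure_pmf_iff assms integrable_measure_pmf_finite)

lemma expec_add:
  assumes "finite (set_pmf p)"
  shows "expec p (\<lambda>x. g x + h x) = expec p g + expec p h"
  using assms by (simp add: integrable_measure_pmf_finite)

lemma expec_sum:
  assumes "finite (set_pmf p)"
  shows "expec p (\<lambda>x. \<Sum>j\<in>J. g j x) = (\<Sum>j\<in>J. expec p (g j))"
  using assms by (simp add: integrable_measure_pmf_finite)

lemma vari_eq:
  assumes "finite (set_pmf p)"
  shows "vari p h = expec p (\<lambda>x. (h x)\<^sup>2) - (expec p h)\<^sup>2"
  using assms by (intro measure_pmf.variance_eq integrable_measure_pmf_finite)

lemma vari_cong:
  assumes "\<And>x. x \<in> set_pmf p \<Longrightarrow> g x = h x"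
  shows "vari p g = vari p h"
  using expec_cong[of p g h] assms by (auto intro!: expec_cong)

lemma vari_bind:
  assumes p: "finite (set_pmf p)" and K: "\<And>x. x \<in> set_pmf p \<Longrightarrow> finite (set_pmf (K x))"
  shows "vari (bind_pmf p K) h =
    expec p (\<lambda>x. vari (K x) h) + vari p (\<lambda>x. expec (K x) h)"
proof -
  have "finite (set_pmf (bind_pmf p K))"
    using p K by simp
  moreover have "expec p (\<lambda>x. vari (K x) h) =
      expec p (\<lambda>x. expec (K x) (\<lambda>y. (h y)\<^sup>2) - (expec (K x) h)\<^sup>2)"
    by (rule expec_cong) (simp add: vari_eq K)
  ultimately show ?thesis
    unfolding vari_eq[OF p]
    by (subst vari_eq) (simp_all only: expec_bind[OF p K],
        simp add: integrable_measure_pmf_finite[OF p])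
qed

lemma expec_of_bool_eq: "expec P (\<lambda>i. of_bool (i = j)) = pmf P j"
proof -
  have "expec P (\<lambda>i. of_bool (i = j)) = expec P (indicat_real {j})"
    by (rule expec_cong) (auto simp: indicator_def)
  thus ?thesis by (simp add: pmf.rep_eq)
qed

lemma expec_single:
  "expec P (\<lambda>i. u + \<Delta> * of_bool (i = j)) = u + \<Delta> * pmf P j"
proof -
  have "integrable (measure_pmf P) (\<lambda>i. of_bool (i = j) :: real)"
    by (rule measure_pmf.integrable_const_bound[where B = 1]) auto
  thus ?thesis by (simp add: expec_of_bool_eq)
qed

text \<open>The squared deviation from the mean takes one value at \<open>i = j\<close> and another
  elsewhere, so it is again a constant plus a multiple of the indicator, and
  \<open>expec_single\<close> applies a second time.\<close>

lemma vari_single: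
  "vari P (\<lambda>i. u + \<Delta> * of_bool (i = j)) = \<Delta>\<^sup>2 * pmf P j * (1 - pmf P j)"
proof -
  let ?p = "pmf P j"
  have "vari P (\<lambda>i. u + \<Delta> * of_bool (i = j)) =
      expec P (\<lambda>i. (\<Delta> * ?p)\<^sup>2 + ((\<Delta> - \<Delta> * ?p)\<^sup>2 - (\<Delta> * ?p)\<^sup>2) * of_bool (i = j))"
    unfolding expec_single[of P u] by (rule expec_cong) (auto simp: power2_eq_square algebra_simps)
  also have "\<dots> = \<Delta>\<^sup>2 * ?p * (1 - ?p)"
    unfolding expec_single by (simp add: power2_eq_square algebra_simps)
  finally show ?thesis .
qed

text \<open>Products of two different indicators vanish, so the variance on the left is
  \<open>S3 - S2\<^sup>2\<close>; the sum of variances on the right is \<open>S3 - S4\<close>. What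
  remains is \<open>2 * S4 \<le> S3 + S2\<^sup>2\<close>.\<close>

lemma vari_exclusive:
  fixes u \<Delta> :: "'a \<Rightarrow> real"
  assumes P: "finite (set_pmf P)" and J: "finite J"
  shows "vari P (\<lambda>i. \<Sum>j\<in>J. u j + \<Delta> j * of_bool (i = j)) \<le>
    2 * (\<Sum>j\<in>J. vari P (\<lambda>i. u j + \<Delta> j * of_bool (i = j)))"
proof -
  let ?p = "pmf P"
  define U where "U = (\<Sum>j\<in>J. u j)"
  define X where "X i = (\<Sum>j\<in>J. \<Delta> j * of_bool (i = j))" for i
  define S1 where "S1 = (\<Sum>j\<in>J. ?p j)"
  define S2 where "S2 = (\<Sum>j\<in>J. ?p j * \<Delta> j)"
  define S3 where "S3 = (\<Sum>j\<in>J. ?p j * (\<Delta> j)\<^sup>2)"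
  define S4 where "S4 = (\<Sum>j\<in>J. (?p j * \<Delta> j)\<^sup>2)"
  have S1: "S1 \<le> 1"
    unfolding S1_def using sum_pmf_eq_1[of J] measure_pmf.prob_le_1[of P J]
    by (simp add: measure_measure_pmf_finite J)
  have S3: "S3 \<ge> 0" unfolding S3_def by (intro sum_nonneg) auto
  have EX: "expec P X = S2"
    unfolding X_def S2_def expec_sum[OF P]
    by (simp add: expec_of_bool_eq mult.commute)
  have "X i ^ 2 = (\<Sum>j\<in>J. (\<Delta> j)\<^sup>2 * of_bool (i = j))" for i
    unfolding X_def of_bool_def using J
    by (simp add: if_distrib[of "\<lambda>x. _ * x"] sum.delta' power2_eq_square cong: if_cong)
  hence EX2: "expec P (\<lambda>i. (X i)\<^sup>2) = S3"
    unfolding S3_def by (simp add: expec_sum[OF P] expec_of_bool_eq mult.commute)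
  have "vari P (\<lambda>i. \<Sum>j\<in>J. u j + \<Delta> j * of_bool (i = j)) = vari P (\<lambda>i. U + X i)"
    by (simp add: U_def X_def sum.distrib)
  also have "\<dots> = vari P X"
    using P by (simp add: integrable_measure_pmf_finite)
  also have "\<dots> = S3 - S2\<^sup>2"
    by (subst vari_eq[OF P]) (simp only: EX EX2)
  finally have L: "vari P (\<lambda>i. \<Sum>j\<in>J. u j + \<Delta> j * of_bool (i = j)) = S3 - S2\<^sup>2" .
  have R: "(\<Sum>j\<in>J. vari P (\<lambda>i. u j + \<Delta> j * of_bool (i = j))) = S3 - S4"
    unfolding vari_single S3_def S4_def
    by (simp add: sum_subtractf[symmetric] power2_eq_square algebra_simps)
  \<comment> \<open>The diagonal of the nonnegative double sum of
    \<open>?p i * ?p j * (\<Delta> i + \<Delta> j)\<^sup>2\<close> is \<open>4 * S4\<close>, while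
    the whole sum is \<open>2 * (S1 * S3) + 2 * S2\<^sup>2\<close> with
    \<open>S1 \<le> 1\<close>.\<close>
  have "4 * S4 = (\<Sum>i\<in>J. ?p i * ?p i * (\<Delta> i + \<Delta> i)\<^sup>2)"
    unfolding S4_def sum_distrib_left by (rule sum.cong) (auto simp: power2_eq_square algebra_simps)
  also have "\<dots> \<le> (\<Sum>i\<in>J. \<Sum>j\<in>J. ?p i * ?p j * (\<Delta> i + \<Delta> j)\<^sup>2)"
    by (intro sum_mono member_le_sum) (use J in auto)
  also have "\<dots> = (\<Sum>i\<in>J. \<Sum>j\<in>J. (?p i * (\<Delta> i)\<^sup>2) * ?p j + ?p i * (?p j * (\<Delta> j)\<^sup>2) +
      2 * ((?p i * \<Delta> i) * (?p j * \<Delta> j)))"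
    by (intro sum.cong refl) (auto simp: power2_eq_square algebra_simps)
  also have "\<dots> = 2 * (S1 * S3) + 2 * S2\<^sup>2"
    by (simp add: sum.distrib sum_distrib_left[symmetric] sum_distrib_right[symmetric]
        S1_def[symmetric] S2_def[symmetric] S3_def[symmetric] power2_eq_square[of S2])
  also have "\<dots> \<le> 2 * S3 + 2 * S2\<^sup>2"
    using mult_right_mono[OF S1 S3] by simp
  finally have "2 * S4 \<le> S3 + S2\<^sup>2" by simp
  thus ?thesis unfolding L R right_diff_distrib by linarith
qed

subsection \<open>Degrees of classes of nodes\<close>

lemma deg_identify_add_node_edge:
  fixes f :: "nat \<Rightarrow> nat"
  shows "deg (identify_nodes f (add_node_edge t s G)) j =
   deg (identify_nodes f G) j + of_bool (f t = j) + of_bool (f s = j)"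
proof -
  have "identify_nodes f (add_node_edge t s G) = add_node_edge (f t) (f s) (identify_nodes f G)"
    by (simp add: identify_nodes_def add_node_edge_def)
  thus ?thesis by (auto simp: deg_add_node_edge)
qed

text \<open>After \<open>n\<close> steps the nodes are \<open>{1..n}\<close>, so class sizes are
  deterministic and only class degrees are random.\<close>

definition csize :: "(nat \<Rightarrow> nat) \<Rightarrow> nat \<Rightarrow> nat \<Rightarrow> nat" where
  "csize f j n = card {v \<in> {1..n}. f v = j}"

lemma csize_0 [simp]: "csize f j 0 = 0"
  by (simp add: csize_def)

lemma csize_Suc: "csize f j (Suc n) = csize f j n + of_bool (f (Suc n) = j)"
proof -
  have "{v \<in> {1..Suc n}. f v = j} =
      (if f (Suc n) = j then insert (Suc n) {v \<in> {1..n}. f v = j} else {v \<in> {1..n}. f v = j})"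
    by (auto simp: le_Suc_eq)
  thus ?thesis by (simp add: csize_def)
qed

lemma set_pmf_attach_target:
  assumes "a > 0" "n \<ge> 1" "G \<in> set_pmf (BO1 a n)"
  shows "set_pmf (attach_target a (Suc n) G) \<subseteq> {1..Suc n}"
proof
  fix s assume "s \<in> set_pmf (attach_target a (Suc n) G)"
  hence "attach_weight a (Suc n) G s \<noteq> 0"
    using pmf_attach_target[of a "Suc n" G s] assms by (simp add: set_pmf_iff)
  thus "s \<in> {1..Suc n}"
    by (auto simp: attach_weight_def split: if_splits)
qed

lemma finite_set_pmf_attach_target:
  assumes "a > 0" "n \<ge> 1" "G \<in> set_pmf (BO1 a n)"
  shows "finite (set_pmf (attach_target a (Suc n) G))"
  using set_pmf_attach_target[OF assms] by (rule finite_subset) simp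

lemma BO1_Suc:
  assumes "n \<ge> 1"
  shows "BO1 a (Suc n) = bind_pmf (BO1 a n)
    (\<lambda>G. map_pmf (\<lambda>s. add_node_edge (Suc n) s G) (attach_target a (Suc n) G))"
  using assms by (cases n) auto

lemma finite_set_pmf_BO1:
  assumes "a > 0"
  shows "finite (set_pmf (BO1 a n))"
proof (induction n)
  case (Suc n)
  show ?case
  proof (cases "n \<ge> 1")
    case True
    thus ?thesis
      using Suc by (auto simp: BO1_Suc intro!: finite_set_pmf_attach_target[OF assms])
  next
    case False
    hence "n = 0" by simp
    thus ?thesis by simp
  qed
qed simp

lemma set_pmf_BO1_induct [consumes 3, case_names init step]:
  assumes "G \<in> set_pmf (BO1 a n)" "a > 0" "n \<ge> 1"
    and "P 1 (Multigraph {1} {#Upair 1 1#})"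
    and "\<And>n G s. n \<ge> 1 \<Longrightarrow> G \<in> set_pmf (BO1 a n) \<Longrightarrow> P n G \<Longrightarrow> s \<in> {1..Suc n} \<Longrightarrow>
           P (Suc n) (add_node_edge (Suc n) s G)"
  shows "P n G"
  using assms(3,1)
proof (induction n arbitrary: G rule: dec_induct)
  case base
  thus ?case using assms(4) by simp
next
  case (step n)
  then obtain H s where "H \<in> set_pmf (BO1 a n)" "s \<in> set_pmf (attach_target a (Suc n) H)"
    and "G = add_node_edge (Suc n) s H"
    by (auto simp: BO1_Suc)
  thus ?case
    using assms(2,5) step set_pmf_attach_target[of a n H] by blast
qed

lemma deg_identify_loop:
  "deg (identify_nodes f (Multigraph {Suc 0} {#Upair (Suc 0) (Suc 0)#})) j =
     (if f (Suc 0) = j then 2 else 0)"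
  by (simp add: identify_nodes_def deg_def)

lemma nodes_BO1:
  assumes "G \<in> set_pmf (BO1 a n)" "a > 0" "n \<ge> 1"
  shows "nodes G = {1..n}"
  using reachable_BO1[OF assms(2,1,3)] by (simp add: reachable_def)

lemma deg_identify_eq_sum:
  fixes f :: "nat \<Rightarrow> nat"
  assumes "G \<in> set_pmf (BO1 a n)" "a > 0" "n \<ge> 1"
  shows "deg (identify_nodes f G) j = (\<Sum>v | v \<in> {1..n} \<and> f v = j. deg G v)"
  using assms
proof (induction rule: set_pmf_BO1_induct)
  case init
  have "{v. v = Suc 0 \<and> f v = j} = (if f 1 = j then {1} else {})" by auto
  moreover have "deg (Multigraph {1 :: nat} {#Upair 1 1#}) 1 = 2" by (simp add: deg_def)
  ultimately show ?case by (simp add: deg_identify_loop)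
next
  case (step n G s)
  have "0 < deg G v \<longleftrightarrow> v \<in> {1..n}" for v
    using reachable_BO1[of a G n] assms(2) step unfolding reachable_def by blast
  from this[of "Suc n"] have "deg G (Suc n) = 0" by simp
  have eq: "(\<Sum>v | v \<in> {1..m} \<and> f v = j. g v) = (\<Sum>v\<in>{1..m}. of_bool (f v = j) * g v)"
    for m and g :: "nat \<Rightarrow> nat"
    by (auto simp: of_bool_def if_distrib[of "\<lambda>x. x * _"] sum.If_cases Int_def cong: if_cong)
  have delta: "(\<Sum>v\<in>{1..Suc n}. of_bool (f v = j) * of_bool (v = s)) = (of_bool (f s = j) :: nat)"
    if "s \<in> {1..Suc n}" for s
  proof -
    have "(\<Sum>v\<in>{1..Suc n}. of_bool (f v = j) * of_bool (v = s)) =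
        (\<Sum>v\<in>{1..Suc n}. if v = s then of_bool (f s = j) else (0 :: nat))"
      by (rule sum.cong) auto
    also have "\<dots> = of_bool (f s = j)"
      using that by (simp only: sum.delta finite_atLeastAtMost if_True)
    finally show ?thesis .
  qed
  have "(\<Sum>v\<in>{1..Suc n}. of_bool (f v = j) * deg (add_node_edge (Suc n) s G) v) =
      (\<Sum>v\<in>{1..Suc n}. of_bool (f v = j) * deg G v) +
      (\<Sum>v\<in>{1..Suc n}. of_bool (f v = j) * of_bool (v = Suc n)) +
      (\<Sum>v\<in>{1..Suc n}. of_bool (f v = j) * of_bool (v = s))"
    unfolding sum.distrib[symmetric] by (simp add: deg_add_node_edge algebra_simps)
  also have "\<dots> = deg (identify_nodes f G) j + of_bool (f (Suc n) = j) + of_bool (f s = j)"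
    unfolding delta[OF \<open>s \<in> {1..Suc n}\<close>] using delta[of "Suc n"] step \<open>deg G (Suc n) = 0\<close> eq[of "deg G" n]
    by simp
  finally show ?case
    unfolding eq deg_identify_add_node_edge by simp
qed

lemma csize_le_deg:
  assumes "G \<in> set_pmf (BO1 a n)" "a > 0" "n \<ge> 1"
  shows "csize f j n \<le> deg (identify_nodes f G) j"
  using assms
  by (induction rule: set_pmf_BO1_induct) (auto simp: csize_Suc deg_identify_add_node_edge deg_identify_loop)

text \<open>Each step gives the class at most one random end besides the fixed end at the new node,
  which \<open>csize\<close> counts; the initial loop likewise has one extra end.\<close>

lemma deg_le_csize_plus:
  assumes "G \<in> set_pmf (BO1 a n)" "a > 0" "n \<ge> 1"
  shows "deg (identify_nodes f G) j \<le> csize f j n + n"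
  using assms
  by (induction rule: set_pmf_BO1_induct) (auto simp: csize_Suc deg_identify_add_node_edge deg_identify_loop)

text \<open>
  The probability that the edge added in step \<open>n + 1\<close> picks a target in class \<open>j\<close>, if class \<open>j\<close> has
  degree \<open>D\<close> after step \<open>n\<close>. The new node \<open>n + 1\<close> is a possible target, so that its class, which may be
  incomplete, obeys the same formula as all the others.
\<close>

definition class_prob :: "real \<Rightarrow> (nat \<Rightarrow> nat) \<Rightarrow> nat \<Rightarrow> nat \<Rightarrow> nat \<Rightarrow> real" where
  "class_prob a f n j D =
     (real D - real (csize f j n) + a * real (csize f j (Suc n))) / ((a + 1) * real (Suc n) - 1)"

text \<open>The attachment weights are summed over the class. The new node contributes only
  \<open>a\<close>, which turns \<open>a * csize f j n\<close> into
  \<open>a * csize f j (Suc n)\<close> in the numerator.\<close>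

lemma pmf_class_target:
  assumes "a > 0" "n \<ge> 1" "G \<in> set_pmf (BO1 a n)"
  shows "pmf (map_pmf f (attach_target a (Suc n) G)) j =
           class_prob a f n j (deg (identify_nodes f G) j)"
proof -
  let ?P = "attach_target a (Suc n) G"
  let ?T = "(a + 1) * real (Suc n) - 1"
  have sub: "set_pmf ?P \<subseteq> {1..Suc n}" using set_pmf_attach_target[OF assms] .
  have "pmf (map_pmf f ?P) j = measure ?P {v. f v = j}"
    by (simp add: pmf.rep_eq vimage_def)
  also have "\<dots> = measure ?P {v \<in> {1..Suc n}. f v = j}"
    using sub by (intro measure_prob_cong_0) (auto simp: set_pmf_iff)
  also have "\<dots> = (\<Sum>v | v \<in> {1..Suc n} \<and> f v = j. pmf ?P v)"
    by (subst measure_measure_pmf_finite) auto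
  also have "\<dots> = (\<Sum>v | v \<in> {1..Suc n} \<and> f v = j. attach_weight a (Suc n) G v)"
    using pmf_attach_target[of a "Suc n" G] assms by simp
  also have "{v \<in> {1..Suc n}. f v = j} =
      {v \<in> {1..n}. f v = j} \<union> (if f (Suc n) = j then {Suc n} else {})"
    by (auto simp: le_Suc_eq)
  also have "(\<Sum>v\<in>\<dots>. attach_weight a (Suc n) G v) =
      (\<Sum>v | v \<in> {1..n} \<and> f v = j. attach_weight a (Suc n) G v) +
      of_bool (f (Suc n) = j) * attach_weight a (Suc n) G (Suc n)"
    by (subst sum.union_disjoint) auto
  also have "(\<Sum>v | v \<in> {1..n} \<and> f v = j. attach_weight a (Suc n) G v) =
      (\<Sum>v | v \<in> {1..n} \<and> f v = j. real (deg G v) - 1 + a) / ?T"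
    unfolding sum_divide_distrib by (intro sum.cong) (auto simp: attach_weight_def)
  also have "(\<Sum>v | v \<in> {1..n} \<and> f v = j. real (deg G v) - 1 + a) =
      real (deg (identify_nodes f G) j) - real (csize f j n) + a * real (csize f j n)"
    unfolding deg_identify_eq_sum[OF assms(3,1,2)] csize_def
    by (simp add: sum.distrib sum_subtractf algebra_simps)
  also have "attach_weight a (Suc n) G (Suc n) = a / ?T"
    by (simp add: attach_weight_def)
  finally show ?thesis
    by (simp add: class_prob_def csize_Suc add_divide_distrib diff_divide_distrib distrib_left)
qed

text \<open>The one-step transition operator for the degree of class \<open>j\<close>:
  \<open>D'\<close> includes the fixed end at the new node, and the random end adds one with
  probability \<open>class_prob\<close>. The result is again a function of the degree of this class
  alone.\<close>

definition next_val :: "real \<Rightarrow> (nat \<Rightarrow> nat) \<Rightarrow> nat \<Rightarrow> nat \<Rightarrow> (nat \<Rightarrow> real) \<Rightarrow> nat \<Rightarrow> real" where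
  "next_val a f n j h D = (let D' = D + of_bool (f (Suc n) = j) in
     h D' + (h (Suc D') - h D') * class_prob a f n j D)"

text \<open>Given \<open>G\<close>, the value of \<open>h j\<close> at the next degree is a constant
  plus a multiple of the indicator that the random end lies in class \<open>j\<close>. These events
  exclude each other, so \<open>expec_single\<close> and \<open>vari_exclusive\<close>
  apply.\<close>

lemma
  assumes "a > 0" "n \<ge> 1" "G \<in> set_pmf (BO1 a n)"
  fixes h :: "nat \<Rightarrow> nat \<Rightarrow> real" and f :: "nat \<Rightarrow> nat"
  defines "P \<equiv> map_pmf (\<lambda>s. add_node_edge (Suc n) s G) (attach_target a (Suc n) G)"
    and "D \<equiv> \<lambda>j H. deg (identify_nodes f H) j"
  shows expec_step: "expec P (\<lambda>H. g (D j H)) = next_val a f n j g (D j G)"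
    and vari_step: "finite J \<Longrightarrow> vari P (\<lambda>H. \<Sum>j\<in>J. h j (D j H)) \<le>
      2 * (\<Sum>j\<in>J. vari P (\<lambda>H. h j (D j H)))"
proof -
  let ?T = "attach_target a (Suc n) G"
  let ?Q = "map_pmf f ?T"
  define D' where "D' j = D j G + of_bool (f (Suc n) = j)" for j
  have step: "h (D j (add_node_edge (Suc n) s G)) =
      h (D' j) + (h (Suc (D' j)) - h (D' j)) * of_bool (f s = j)" for h :: "nat \<Rightarrow> real" and j s
    by (auto simp: D_def D'_def deg_identify_add_node_edge)
  have "expec P (\<lambda>H. g (D j H)) =
      expec ?Q (\<lambda>i. g (D' j) + (g (Suc (D' j)) - g (D' j)) * of_bool (i = j))"
    unfolding P_def integral_map_pmf step ..
  also have "\<dots> = next_val a f n j g (D j G)"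
    unfolding expec_single pmf_class_target[OF assms(1-3)] by (simp add: next_val_def D'_def D_def Let_def)
  finally show "expec P (\<lambda>H. g (D j H)) = next_val a f n j g (D j G)" .
  assume J: "finite J"
  have "finite (set_pmf ?Q)"
    using finite_set_pmf_attach_target[OF assms(1-3)] by simp
  from vari_exclusive[OF this J, of "\<lambda>j. h j (D' j)" "\<lambda>j. h j (Suc (D' j)) - h j (D' j)"]
  show "vari P (\<lambda>H. \<Sum>j\<in>J. h j (D j H)) \<le> 2 * (\<Sum>j\<in>J. vari P (\<lambda>H. h j (D j H)))"
    unfolding P_def integral_map_pmf step .
qed

lemma expec_BO1_Suc:
  assumes "a > 0" "n \<ge> 1"
  shows "expec (BO1 a (Suc n)) (\<lambda>G. h (deg (identify_nodes f G) j)) =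
         expec (BO1 a n) (\<lambda>G. next_val a f n j h (deg (identify_nodes f G) j))"
  unfolding BO1_Suc[OF assms(2)]
  by (subst expec_bind)
     (auto simp del: integral_map_pmf intro!: expec_cong expec_step
       finite_set_pmf_BO1 finite_set_pmf_attach_target assms)

text \<open>The factor 2 does not grow with \<open>n\<close>: the conditional variance and the
  variance of the conditional mean are bounded separately, each with factor 2, and recombine for
  every \<open>j\<close>. The induction needs arbitrary \<open>h\<close>, because conditioning
  replaces \<open>h j\<close> by \<open>next_val\<close>.\<close>

lemma vari_sum_le:
  fixes h :: "nat \<Rightarrow> nat \<Rightarrow> real"
  assumes a: "a > 0" and n: "n \<ge> 1" and J: "finite J"
  shows "vari (BO1 a n) (\<lambda>G. \<Sum>j\<in>J. h j (deg (identify_nodes f G) j)) \<le>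
    2 * (\<Sum>j\<in>J. vari (BO1 a n) (\<lambda>G. h j (deg (identify_nodes f G) j)))"
  using n
proof (induction n arbitrary: h rule: dec_induct)
  case base
  show ?case by simp
next
  case (step n)
  let ?p = "BO1 a n"
  let ?D = "\<lambda>j G. deg (identify_nodes f G) j"
  let ?K = "\<lambda>G. map_pmf (\<lambda>s. add_node_edge (Suc n) s G) (attach_target a (Suc n) G)"
  have p: "finite (set_pmf ?p)" using finite_set_pmf_BO1[OF a] .
  have K: "finite (set_pmf (?K G))" if "G \<in> set_pmf ?p" for G
    using finite_set_pmf_attach_target[OF a _ that] step by simp
  have E1: "expec (?K G) (\<lambda>H. h j (?D j H)) = next_val a f n j (h j) (?D j G)"
    if "G \<in> set_pmf ?p" for G j
    using expec_step[OF a _ that] step by simp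
  have E2: "expec (?K G) (\<lambda>H. \<Sum>j\<in>J. h j (?D j H)) = (\<Sum>j\<in>J. next_val a f n j (h j) (?D j G))"
    if "G \<in> set_pmf ?p" for G
    unfolding expec_sum[OF K[OF that]] using E1[OF that] by (simp del: integral_map_pmf)
  have "vari (bind_pmf ?p ?K) (\<lambda>G. \<Sum>j\<in>J. h j (?D j G)) =
      expec ?p (\<lambda>G. vari (?K G) (\<lambda>H. \<Sum>j\<in>J. h j (?D j H))) +
      vari ?p (\<lambda>G. expec (?K G) (\<lambda>H. \<Sum>j\<in>J. h j (?D j H)))"
    by (rule vari_bind[OF p K])
  also have "\<dots> = expec ?p (\<lambda>G. vari (?K G) (\<lambda>H. \<Sum>j\<in>J. h j (?D j H))) +
      vari ?p (\<lambda>G. \<Sum>j\<in>J. next_val a f n j (h j) (?D j G))"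
    by (intro arg_cong2[where f = "(+)"] vari_cong refl E2)
  also have "\<dots> \<le> expec ?p (\<lambda>G. 2 * (\<Sum>j\<in>J. vari (?K G) (\<lambda>H. h j (?D j H)))) +
      2 * (\<Sum>j\<in>J. vari ?p (\<lambda>G. next_val a f n j (h j) (?D j G)))"
    by (intro add_mono step.IH expec_mono[OF p] vari_step[OF a _ _ J]) (use step in auto)
  also have "expec ?p (\<lambda>G. 2 * (\<Sum>j\<in>J. vari (?K G) (\<lambda>H. h j (?D j H)))) =
      2 * (\<Sum>j\<in>J. expec ?p (\<lambda>G. vari (?K G) (\<lambda>H. h j (?D j H))))"
    unfolding integral_mult_right_zero expec_sum[OF p] ..
  also have "\<dots> + 2 * (\<Sum>j\<in>J. vari ?p (\<lambda>G. next_val a f n j (h j) (?D j G))) =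
      2 * (\<Sum>j\<in>J. expec ?p (\<lambda>G. vari (?K G) (\<lambda>H. h j (?D j H))) +
        vari ?p (\<lambda>G. next_val a f n j (h j) (?D j G)))"
    by (simp only: sum.distrib distrib_left)
  also have "\<dots> = 2 * (\<Sum>j\<in>J. expec ?p (\<lambda>G. vari (?K G) (\<lambda>H. h j (?D j H))) +
        vari ?p (\<lambda>G. expec (?K G) (\<lambda>H. h j (?D j H))))"
    by (intro arg_cong2[where f = "(*)"] arg_cong2[where f = "(+)"] sum.cong refl vari_cong)
       (simp only: E1)
  also have "\<dots> = 2 * (\<Sum>j\<in>J. vari (bind_pmf ?p ?K) (\<lambda>G. h j (?D j G)))"
    by (intro arg_cong2[where f = "(*)"] sum.cong refl vari_bind[OF p K, symmetric])
  finally show ?case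
    unfolding BO1_Suc[OF step(1)] .
qed

subsection \<open>The limiting densities\<close>

text \<open>
  \<open>wt a k d / tot a n\<close> is the probability that the edge added in step \<open>n + 1\<close> picks a given complete
  block of degree \<open>d\<close>.
\<close>

definition wt :: "real \<Rightarrow> nat \<Rightarrow> nat \<Rightarrow> real" where
  "wt a k d = real d - real k + real k * a"

definition tot :: "real \<Rightarrow> nat \<Rightarrow> real" where
  "tot a n = (a + 1) * real (Suc n) - 1"

definition dens :: "real \<Rightarrow> nat \<Rightarrow> nat \<Rightarrow> real" where
  "dens a k d = Beta (wt a k d) (a + 2) / Beta (real k * a) (a + 1)"

text \<open>By convexity, \<open>x powr q\<close> lies above its tangent at
  \<open>1\<close>.\<close>

lemma Bernoulli_powr:
  fixes u q :: real
  assumes "0 \<le> u" "u < 1" "q \<ge> 1"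
  shows "1 - q * u \<le> (1 - u) powr q"
proof -
  have "((\<lambda>x. x powr q) has_real_derivative q) (at 1 within {0<..})"
    by (auto intro!: derivative_eq_intros)
  with convex_on_imp_above_tangent[OF powr_convex[OF \<open>q \<ge> 1\<close>], of 1 "1 - u" q]
  show ?thesis using assms by (simp add: interior_open)
qed

lemma pos_not_nonpos_Ints: "x > 0 \<Longrightarrow> x \<notin> \<int>\<^sub>\<le>\<^sub>0" for x :: real
  by (auto elim!: nonpos_Ints_cases)

context
  fixes a :: real and k :: nat
  assumes a: "a > 0" and k: "k \<ge> 1"
begin

lemma wt_ge: "d \<ge> k \<Longrightarrow> wt a k d \<ge> real k * a"
  by (simp add: wt_def)

lemma wt_pos: "d \<ge> k \<Longrightarrow> wt a k d > 0"
  using wt_ge[of d] a k by (smt (verit) mult_pos_pos of_nat_0_less_iff less_le_trans zero_less_one)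

lemma wt_pred: "d > k \<Longrightarrow> wt a k (d - 1) = wt a k d - 1"
  by (simp add: wt_def of_nat_diff)

lemma tot_pos: "tot a n > 0"
  using a by (simp add: tot_def algebra_simps add_pos_nonneg)

lemma tot_Suc: "tot a (Suc n) = tot a n + a + 1"
  by (simp add: tot_def algebra_simps)

lemma dens_pos:
  assumes "d \<ge> k"
  shows "dens a k d > 0"
  unfolding dens_def Beta_def using wt_pos[OF assms] a k
  by (intro divide_pos_pos mult_pos_pos Gamma_real_pos) (auto intro!: add_pos_pos)

text \<open>The functional equation of Beta in its second argument. It makes
  \<open>dens a k k * tot a n / (real k * (a + 1))\<close> solve the mean recursion at
  \<open>d = k\<close> with source \<open>1 / k\<close> in every step.\<close>

lemma dens_base: "dens a k k * (real k * a + a + 1) = a + 1"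
proof -
  let ?x = "real k * a"
  have x: "?x > 0" using a k by simp
  have "(?x + (a + 1)) * Beta ?x (a + 1 + 1) = (a + 1) * Beta ?x (a + 1)"
    using a by (intro Beta_plus1_right pos_not_nonpos_Ints) simp
  moreover have "Beta ?x (a + 1) \<noteq> 0"
    using x a by (simp add: Beta_def Gamma_eq_zero_iff pos_not_nonpos_Ints)
  ultimately show ?thesis
    by (simp add: dens_def wt_def field_simps)
qed

text \<open>The functional equation of Beta in its first argument; this is the mean recursion for
  \<open>d > k\<close> on solutions proportional to \<open>tot a n\<close>.\<close>

lemma dens_rec:
  assumes "d > k"
  shows "dens a k d * (wt a k d + a + 1) = dens a k (d - 1) * (wt a k d - 1)"
proof -
  let ?x = "wt a k (d - 1)"
  have "?x > 0" using wt_pos[of "d - 1"] assms by simp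
  hence "(?x + (a + 2)) * Beta (?x + 1) (a + 2) = ?x * Beta ?x (a + 2)"
    by (intro Beta_plus1_left pos_not_nonpos_Ints)
  moreover have "wt a k d = ?x + 1" using wt_pred[OF assms] by simp
  moreover have "?x + 1 + a + 1 = ?x + (a + 2)" by simp
  ultimately show ?thesis
    by (simp add: dens_def mult.commute add_ac)
qed

text \<open>
  With \<open>wt a k d\<close> in place of \<open>wt a k d + a + 1\<close> the sequence would increase instead; it is the shift
  that makes Bernoulli's inequality point in the right direction.
\<close>

lemma dens_powr_le:
  assumes "d \<ge> k"
  shows "dens a k d * (wt a k d + a + 1) powr (a + 2) \<le>
         dens a k k * (real k * a + a + 1) powr (a + 2)"
  using assms
proof (induction d rule: dec_induct)
  case base
  show ?case by (simp add: wt_def)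
next
  case (step d)
  define x where "x = wt a k d"
  have x: "x > 0" using step wt_pos x_def by simp
  have wS: "wt a k (Suc d) = x + 1" by (simp add: x_def wt_def)
  \<comment> \<open>With the reciprocal \<open>u\<close> of the next shifted weight,
    \<open>1 - u\<close> is the ratio of consecutive shifted weights and
    \<open>1 - (a + 2) * u\<close> the ratio of consecutive densities.\<close>
  define u where "u = 1 / (x + a + 2)"
  have u: "0 \<le> u" "u < 1" using x a by (auto simp: u_def)
  have "dens a k (Suc d) * (x + a + 2) = dens a k d * x"
    using dens_rec[of "Suc d"] step by (simp add: wS algebra_simps)
  hence "dens a k (Suc d) = dens a k d * (x / (x + a + 2))"
    using x a by (simp add: field_simps)
  also have "x / (x + a + 2) = 1 - (a + 2) * u"
    using x a by (simp add: u_def field_simps)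
  finally have eq: "dens a k (Suc d) = dens a k d * (1 - (a + 2) * u)" .
  have "dens a k (Suc d) * (x + a + 2) powr (a + 2) \<le>
      dens a k d * (1 - u) powr (a + 2) * (x + a + 2) powr (a + 2)"
    unfolding eq using dens_pos[of d] step u a
    by (intro mult_right_mono mult_left_mono Bernoulli_powr) auto
  also have "\<dots> = dens a k d * ((1 - u) * (x + a + 2)) powr (a + 2)"
    using u x a by (simp add: powr_mult)
  also have "(1 - u) * (x + a + 2) = x + a + 1"
    using x a by (simp add: u_def field_simps)
  finally show ?case
    using step.IH by (simp add: wS x_def[symmetric] add_ac)
qed

lemma dens_le:
  obtains B where "B > 0" "\<And>d. d \<ge> k \<Longrightarrow> dens a k d \<le> B * wt a k d powr (- a - 2)"
proof -
  define B where "B = dens a k k * (real k * a + a + 1) powr (a + 2)"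
  have "B > 0"
  proof -
    have "real k * a + a + 1 > 0" using a by (simp add: add_nonneg_pos)
    thus ?thesis unfolding B_def using dens_pos[of k] by (intro mult_pos_pos) auto
  qed
  moreover have "dens a k d \<le> B * wt a k d powr (- a - 2)" if "d \<ge> k" for d
  proof -
    have w: "wt a k d > 0" using wt_pos[OF that] .
    have "dens a k d * wt a k d powr (a + 2) \<le> dens a k d * (wt a k d + a + 1) powr (a + 2)"
      using w a dens_pos[OF that] by (intro mult_left_mono powr_mono2) auto
    also have "\<dots> \<le> B" unfolding B_def using dens_powr_le[OF that] .
    finally have "dens a k d * wt a k d powr (a + 2) * wt a k d powr (- a - 2) \<le>
        B * wt a k d powr (- a - 2)"
      by (rule mult_right_mono) simp
    moreover have "wt a k d powr (a + 2) * wt a k d powr (- a - 2) = 1"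
      using w by (simp add: powr_add[symmetric])
    ultimately show ?thesis by (simp add: mult.assoc)
  qed
  ultimately show ?thesis using that by blast
qed

text \<open>The exponent left over is \<open>- a\<close>, and \<open>wt\<close> is bounded below by
  \<open>real k * a\<close>. The bound allows \<open>dens\<close> times a weight to be absorbed into
  an error of order \<open>1 / wt a k d\<close>.\<close>

lemma dens_sq_le:
  obtains B where "B > 0" "\<And>d. d \<ge> k \<Longrightarrow> dens a k d * (wt a k d)\<^sup>2 \<le> B"
proof -
  obtain B where B: "B > 0" "\<And>d. d \<ge> k \<Longrightarrow> dens a k d \<le> B * wt a k d powr (- a - 2)"
    using dens_le by blast
  have "dens a k d * (wt a k d)\<^sup>2 \<le> B * (real k * a) powr (- a)" if "d \<ge> k" for d
  proof -
    have w: "wt a k d > 0" using wt_pos[OF that] .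
    have "dens a k d * (wt a k d)\<^sup>2 \<le> B * wt a k d powr (- a - 2) * (wt a k d)\<^sup>2"
      using B(2)[OF that] by (intro mult_right_mono) auto
    also have "\<dots> = B * wt a k d powr (- a)"
    proof -
      have "(wt a k d)\<^sup>2 = wt a k d powr 2" using w by (simp add: powr_numeral)
      thus ?thesis using powr_add[of "wt a k d" "- a - 2" 2] by (simp add: mult.assoc)
    qed
    also have "\<dots> \<le> B * (real k * a) powr (- a)"
      using B w wt_ge[OF that] a k by (intro mult_left_mono powr_mono2') auto
    finally show ?thesis .
  qed
  moreover have "B * (real k * a) powr (- a) > 0" using B a k by simp
  ultimately show ?thesis using that by blast
qed

text \<open>
  The term with \<open>n mod k\<close> absorbs the difference between the source in every \<open>k\<close>-th step and its average
  \<open>1 / k\<close>, so that the error obeys the same recursion with a source \<open>O(1 / n)\<close> on \<open>k \<le> d \<le> 2 k\<close>. It is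
  bounded because \<open>1 / wt a k d\<close> is a stationary solution of the recursion for \<open>d > k\<close>. The recursion
  preserves bounds only if \<open>wt a k d \<le> tot a n\<close>, which holds for all \<open>d \<le> n + k + 1\<close> once \<open>n\<close> is large.
\<close>

lemma recursion_estimate:
  fixes E q :: "nat \<Rightarrow> nat \<Rightarrow> real" and C :: real
  assumes C: "C \<ge> 0"
    and rec: "\<And>d n. n \<ge> k \<Longrightarrow> d \<ge> k \<Longrightarrow> E d (Suc n) = (1 - wt a k d / tot a n) * E d n +
       (wt a k d - 1) / tot a n * E (d - 1) n + (if Suc n mod k = 0 then q d n else 0)"
    and q: "\<And>d n. n \<ge> k \<Longrightarrow> Suc n mod k = 0 \<Longrightarrow> \<bar>q d n - of_bool (d = k)\<bar> \<le> C / tot a n"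
    and q0: "\<And>d n. n \<ge> k \<Longrightarrow> Suc n mod k = 0 \<Longrightarrow> d > 2 * k \<Longrightarrow> q d n = 0"
    and E0: "\<And>d n. n \<ge> k \<Longrightarrow> d < k \<or> d > n + k \<Longrightarrow> E d n = 0"
  obtains A N where "A \<ge> 0" "\<And>d n. n \<ge> N \<Longrightarrow> d \<ge> k \<Longrightarrow>
    \<bar>E d n - (dens a k d * tot a n / (real k * (a + 1)) -
      of_bool (d = k) * real (n mod k) / real k)\<bar> \<le> A / wt a k d"
proof -
  \<comment> \<open>\<open>F\<close> solves the recursion with the source averaged to
    \<open>1 / k\<close> per step. The sawtooth \<open>\<theta>\<close> rises by
    \<open>1 / k\<close> in each step and drops by 1 whenever a block is completed.\<close>
  define F where "F d n = dens a k d * tot a n / (real k * (a + 1))" for d n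
  define \<theta> where "\<theta> n = real (n mod k) / real k" for n
  define e where "e d n = E d n - (F d n - of_bool (d = k) * \<theta> n)" for d n
  have \<theta>: "0 \<le> \<theta> n" "\<theta> n \<le> 1" for n
    using k by (auto simp: \<theta>_def divide_le_eq order_less_imp_le)
  have \<theta>_Suc: "\<theta> (Suc n) = \<theta> n + 1 / real k - of_bool (Suc n mod k = 0)" for n
  proof (cases "Suc n mod k = 0")
    case True
    hence "Suc (n mod k) = k" by (metis mod_Suc nat.distinct(1))
    hence "real (n mod k) + 1 = real k" by linarith
    hence "\<theta> n + 1 / real k = 1"
      using k by (simp add: \<theta>_def add_divide_distrib[symmetric])
    thus ?thesis using True by (simp add: \<theta>_def)
  next
    case False
    hence "Suc n mod k = Suc (n mod k)" by (simp add: mod_Suc split: if_splits)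
    thus ?thesis using False by (simp add: \<theta>_def add_divide_distrib)
  qed
  define c where "c = real k * (a + 1)"
  have c: "c > 0" using a k by (simp add: c_def)
  have F_wt: "wt a k d / tot a n * F d n = dens a k d * wt a k d / c" for d n
    using tot_pos[of n] by (simp add: F_def c_def[symmetric])
  have dens_k: "dens a k d / real k = dens a k d * (a + 1) / c" for d
    using a k by (simp add: c_def)
  have F_Suc: "F d (Suc n) = F d n + dens a k d / real k" for d n
    unfolding dens_k F_def c_def[symmetric] tot_Suc
    by (simp add: add_divide_distrib[symmetric] algebra_simps)
  have F_rec: "F d (Suc n) = (1 - wt a k d / tot a n) * F d n +
      (wt a k d - 1) / tot a n * F (d - 1) n" if "d > k" for d n
  proof -
    have "dens a k d / real k = dens a k d * (wt a k d + a + 1) / c - wt a k d / tot a n * F d n"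
      unfolding F_wt dens_k by (simp add: diff_divide_distrib[symmetric] algebra_simps)
    also have "dens a k d * (wt a k d + a + 1) / c = (wt a k d - 1) / tot a n * F (d - 1) n"
      using F_wt[of "d - 1" n] by (simp add: dens_rec[OF that] wt_pred[OF that, simplified])
    finally show ?thesis by (simp add: F_Suc algebra_simps)
  qed
  have F_rec_k: "F k (Suc n) = (1 - wt a k k / tot a n) * F k n + 1 / real k" for n
  proof -
    have "dens a k k / real k = dens a k k * (wt a k k + a + 1) / c - wt a k k / tot a n * F k n"
      unfolding F_wt dens_k by (simp add: diff_divide_distrib[symmetric] algebra_simps)
    also have "dens a k k * (wt a k k + a + 1) / c = 1 / real k"
      using dens_base a k by (simp add: wt_def c_def)
    finally show ?thesis by (simp add: F_Suc algebra_simps)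
  qed
  \<comment> \<open>\<open>real k * a\<close> bounds the contribution of the sawtooth: its
    coefficient is \<open>wt a k k / tot a n\<close> at \<open>d = k\<close> and
    \<open>(wt a k d - 1) / tot a n\<close> at \<open>d = k + 1\<close>, and both numerators equal
    \<open>real k * a\<close>.\<close>
  define C2 where "C2 = C + real k * a"
  have C2: "C2 \<ge> 0" using C a by (simp add: C2_def)
  define src where "src d n = (if Suc n mod k = 0 then q d n - of_bool (d = k) else 0)" for d n
  have src: "\<bar>src d n\<bar> \<le> C / tot a n" if "n \<ge> k" for d n
    using q[OF that] C tot_pos[of n] by (auto simp: src_def)
  have src0: "src d n = 0" if "n \<ge> k" "d > 2 * k" for d n
    using q0[OF that(1) _ that(2)] that k by (auto simp: src_def)
  have e_k: "\<bar>e k (Suc n) - (1 - wt a k k / tot a n) * e k n\<bar> \<le> C2 / tot a n" if "n \<ge> k" for n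
  proof -
    have "E k (Suc n) = (1 - wt a k k / tot a n) * E k n + (if Suc n mod k = 0 then q k n else 0)"
      using rec[OF that, of k] E0[OF that, of "k - 1"] k by simp
    hence "e k (Suc n) - (1 - wt a k k / tot a n) * e k n = src k n + wt a k k / tot a n * \<theta> n"
      by (simp add: e_def F_rec_k \<theta>_Suc src_def algebra_simps add_divide_distrib)
    moreover have "wt a k k / tot a n * \<theta> n \<le> wt a k k / tot a n * 1"
      using \<theta> tot_pos[of n] wt_pos[of k] by (intro mult_left_mono) auto
    moreover have "0 \<le> wt a k k / tot a n * \<theta> n"
      using \<theta> tot_pos[of n] wt_pos[of k] by (intro mult_nonneg_nonneg) auto
    moreover have "wt a k k = real k * a" by (simp add: wt_def)
    ultimately show ?thesis
      using src[OF that, of k] by (simp add: C2_def add_divide_distrib abs_le_iff)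
  qed
  have e_d: "\<bar>e d (Suc n) - ((1 - wt a k d / tot a n) * e d n + (wt a k d - 1) / tot a n * e (d - 1) n)\<bar>
      \<le> of_bool (d \<le> 2 * k) * C2 / tot a n" if "n \<ge> k" "d > k" for d n
  proof -
    let ?r = "of_bool (d - 1 = k) * ((wt a k d - 1) / tot a n * \<theta> n)"
    have eq: "e d (Suc n) - ((1 - wt a k d / tot a n) * e d n + (wt a k d - 1) / tot a n * e (d - 1) n)
      = src d n - ?r"
    proof -
      define \<alpha> \<beta> where "\<alpha> = 1 - wt a k d / tot a n" and "\<beta> = (wt a k d - 1) / tot a n"
      have "E d (Suc n) = \<alpha> * E d n + \<beta> * E (d - 1) n + src d n"
        using rec[OF that(1), of d] that(2) by (simp add: src_def \<alpha>_def \<beta>_def)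
      moreover have "F d (Suc n) = \<alpha> * F d n + \<beta> * F (d - 1) n"
        using F_rec[OF that(2)] by (simp add: \<alpha>_def \<beta>_def)
      ultimately show ?thesis
        unfolding \<alpha>_def[symmetric] \<beta>_def[symmetric] using that(2)
        by (simp add: e_def algebra_simps)
    qed
    show ?thesis
    proof (cases "d - 1 = k")
      case True
      hence w: "wt a k d - 1 = real k * a" using that by (simp add: wt_def)
      have "(wt a k d - 1) / tot a n * \<theta> n \<le> (wt a k d - 1) / tot a n * 1"
        using \<theta> tot_pos[of n] a k unfolding w by (intro mult_left_mono) auto
      moreover have "0 \<le> (wt a k d - 1) / tot a n * \<theta> n"
        using \<theta> tot_pos[of n] a k unfolding w by (intro mult_nonneg_nonneg) auto
      moreover have "d \<le> 2 * k" using True k that by linarith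
      ultimately show ?thesis
        unfolding eq using src[OF that(1), of d] True w
        by (simp add: C2_def add_divide_distrib abs_le_iff)
    next
      case False
      have "C / tot a n \<le> C2 / tot a n"
        using a tot_pos[of n] by (intro divide_right_mono) (auto simp: C2_def)
      thus ?thesis
        unfolding eq using False src[OF that(1), of d] src0[OF that(1), of d]
        by (cases "d \<le> 2 * k") auto
    qed
  qed
  obtain Bs where Bs: "Bs > 0" "\<And>d. d \<ge> k \<Longrightarrow> dens a k d * (wt a k d)\<^sup>2 \<le> Bs"
    using dens_sq_le by blast
  \<comment> \<open>From \<open>N\<close> on, \<open>a * (n - k)\<close> is at least 1, which gives
    \<open>wt a k d \<le> tot a n\<close> for \<open>d \<le> Suc n + k\<close>.\<close>
  define N where "N = k + nat \<lceil>1 / a\<rceil>"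
  have N: "1 \<le> a * (real n - real k)" if "n \<ge> N" for n
  proof -
    have "1 / a \<le> real n - real k" using that unfolding N_def by linarith
    thus ?thesis using a by (simp add: field_simps)
  qed
  \<comment> \<open>\<open>Bs\<close> covers the degrees \<open>d > n + k\<close>, where
    \<open>E\<close> vanishes; the finite sum covers the remaining degrees at the initial time
    \<open>N\<close>.\<close>
  define B where "B = Bs + (\<Sum>d\<in>{k..N + k}. \<bar>e d N\<bar> * wt a k d)"
  have "B \<ge> Bs" unfolding B_def
    by (auto intro!: sum_nonneg mult_nonneg_nonneg less_imp_le[OF wt_pos])
  \<comment> \<open>Starting from \<open>B\<close>, the bound grows by \<open>C2\<close> at each
    degree from \<open>k\<close> to \<open>2 * k\<close>, just enough to pay for the source there,
    and is constant beyond, where there is no source.\<close>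
  define Ad where "Ad d = B + C2 * (real (min d (2 * k)) - real k + 1)" for d
  have Ad_ge: "Ad d \<ge> B" if "d \<ge> k" for d
    using that C2 by (simp add: Ad_def)
  \<comment> \<open>Here \<open>e d n = - F d n\<close>, and \<open>n + 1 \<le> wt a k d\<close>
    bounds \<open>tot a n\<close> by \<open>(a + 1) * wt a k d\<close>, so that
    \<open>dens_sq_le\<close> applies.\<close>
  have far: "\<bar>e d n\<bar> \<le> Ad d / wt a k d" if "n \<ge> k" "d > n + k" for d n
  proof -
    have w: "wt a k d > 0" using wt_pos[of d] that by simp
    have "real n + 1 \<le> real d - real k" using that by linarith
    hence n: "real n + 1 \<le> wt a k d" using a k by (simp add: wt_def add_increasing2)
    have dp: "dens a k d > 0" using dens_pos[of d] that by simp
    have "e d n = - F d n" using that k by (simp add: e_def E0)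
    hence "\<bar>e d n\<bar> = dens a k d * tot a n / (real k * (a + 1))"
      using dp tot_pos[of n] a k by (simp add: F_def)
    also have "\<dots> \<le> dens a k d * ((a + 1) * wt a k d) / (1 * (a + 1))"
    proof (intro frac_le mult_left_mono mult_right_mono)
      show "tot a n \<le> (a + 1) * wt a k d"
        using mult_left_mono[OF n, of "a + 1"] a by (simp add: tot_def algebra_simps)
    qed (use dp a k w in auto)
    also have "\<dots> = dens a k d * (wt a k d)\<^sup>2 / wt a k d"
      using w a by (simp add: power2_eq_square)
    also have "\<dots> \<le> Ad d / wt a k d"
      using Bs(2)[of d] Ad_ge[of d] \<open>B \<ge> Bs\<close> that w by (intro divide_right_mono) auto
    finally show ?thesis .
  qed
  have main: "\<bar>e d n\<bar> \<le> Ad d / wt a k d" if "n \<ge> N" "d \<ge> k" for d n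
    using that
  proof (induction n arbitrary: d rule: dec_induct)
    case base
    show ?case
    proof (cases "d \<le> N + k")
      case True
      have w: "wt a k d > 0" using wt_pos[of d] base by simp
      have "\<bar>e d N\<bar> * wt a k d \<le> (\<Sum>d\<in>{k..N + k}. \<bar>e d N\<bar> * wt a k d)"
        using base True by (intro member_le_sum) (auto intro!: mult_nonneg_nonneg less_imp_le[OF wt_pos])
      also have "\<dots> \<le> Ad d" using Ad_ge[OF base] Bs by (simp add: B_def)
      finally show ?thesis using w by (simp add: field_simps)
    next
      case False
      thus ?thesis using far[of N d] by (simp add: N_def)
    qed
  next
    case (step n)
    have nk: "n \<ge> k" using step by (simp add: N_def)
    show ?case
    proof (cases "d \<le> Suc n + k")
      case False
      thus ?thesis using far[of "Suc n" d] nk by simp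
    next
      case True
      let ?w = "wt a k d" and ?T = "tot a n"
      have w: "?w > 0" using wt_pos[of d] step by simp
      have T: "?T > 0" by (rule tot_pos)
      have "?w \<le> real n + 1 + real k * a" using True by (simp add: wt_def)
      also have "\<dots> \<le> ?T" using N[OF step(1)] a by (simp add: tot_def algebra_simps)
      finally have "?w \<le> ?T" .
      hence r: "0 \<le> 1 - ?w / ?T" using T by simp
      have IH: "\<bar>(1 - ?w / ?T) * e d n\<bar> \<le> (1 - ?w / ?T) * (Ad d / ?w)"
        unfolding abs_mult abs_of_nonneg[OF r] by (intro mult_left_mono step.IH[OF step.prems] r)
      \<comment> \<open>The loss \<open>Ad d / ?T\<close> has to cover the inflow from degree
        \<open>d - 1\<close> and the source. With the profile \<open>1 / wt\<close> the inflow is at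
        most \<open>Ad (d - 1) / ?T\<close>, and the increment of \<open>Ad\<close> covers the
        source.\<close>
      have simp1: "(1 - ?w / ?T) * (Ad d / ?w) = Ad d / ?w - Ad d / ?T"
        using w T by (simp add: field_simps)
      show ?thesis
      proof (cases "d = k")
        case True
        have "\<bar>e d (Suc n)\<bar> \<le> Ad d / ?w - Ad d / ?T + C2 / ?T"
          using e_k[OF nk] IH[unfolded simp1] unfolding True by linarith
        also have "\<dots> \<le> Ad d / ?w - Ad d / ?T + Ad d / ?T"
          using T C2 True Bs \<open>B \<ge> Bs\<close> k by (intro add_mono divide_right_mono) (auto simp: Ad_def)
        finally show ?thesis by simp
      next
        case False
        hence dk: "d > k" using step by simp
        have w1: "?w - 1 > 0" using wt_pos[of "d - 1"] wt_pred[OF dk] dk by simp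
        have "\<bar>(?w - 1) / ?T * e (d - 1) n\<bar> = (?w - 1) / ?T * \<bar>e (d - 1) n\<bar>"
          unfolding abs_mult using w1 T by simp
        also have "\<dots> \<le> (?w - 1) / ?T * (Ad (d - 1) / (?w - 1))"
          using step.IH[of "d - 1"] dk w1 T wt_pred[OF dk] by (intro mult_left_mono) auto
        also have "\<dots> = Ad (d - 1) / ?T" using w1 by simp
        finally have "\<bar>e d (Suc n)\<bar> \<le> Ad d / ?w - Ad d / ?T + Ad (d - 1) / ?T +
            of_bool (d \<le> 2 * k) * C2 / ?T"
          using e_d[OF nk dk] IH unfolding simp1 by linarith
        also have "\<dots> = Ad d / ?w - (Ad d - Ad (d - 1) - of_bool (d \<le> 2 * k) * C2) / ?T"
          by (simp add: diff_divide_distrib)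
        also have "Ad d - Ad (d - 1) - of_bool (d \<le> 2 * k) * C2 = 0"
          using dk by (auto simp: Ad_def min_def of_nat_diff algebra_simps)
        finally show ?thesis by simp
      qed
    qed
  qed
  have "\<bar>e d n\<bar> \<le> Ad (2 * k) / wt a k d" if "n \<ge> N" "d \<ge> k" for d n
  proof -
    have "Ad d \<le> Ad (2 * k)"
      unfolding Ad_def using C2 by (intro add_mono mult_left_mono) auto
    thus ?thesis
      using main[OF that] wt_pos[OF that(2)] divide_right_mono[of "Ad d" "Ad (2 * k)" "wt a k d"]
      by linarith
  qed
  moreover have "Ad (2 * k) \<ge> 0" using Ad_ge[of "2 * k"] \<open>B \<ge> Bs\<close> Bs by simp
  ultimately show ?thesis
    using that[of "Ad (2 * k)" N] by (simp add: e_def F_def \<theta>_def)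
qed

end

subsection \<open>Expected number of nodes of given degree\<close>

definition block :: "nat \<Rightarrow> nat \<Rightarrow> nat" where
  "block k v = (v - 1) div k + 1"

text \<open>The index \<open>i\<close> starts at 0: it stands for the merged node
  \<open>Suc i\<close>, which consists of the nodes \<open>k * i + 1\<close> to
  \<open>k * i + k\<close>.\<close>

definition block_deg_prob :: "real \<Rightarrow> nat \<Rightarrow> nat \<Rightarrow> nat \<Rightarrow> nat \<Rightarrow> real" where
  "block_deg_prob a k i d n = expec (BO1 a n) (\<lambda>G. of_bool (deg (identify_nodes (block k) G) (Suc i) = d))"

lemma csize_block:
  assumes "k \<ge> 1"
  shows "csize (block k) (Suc i) n = min k (n - k * i)"
proof (induction n)
  case (Suc n)
  have "n div k = i \<longleftrightarrow> k * i \<le> n \<and> n < k * i + k"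
  proof -
    have "i \<le> n div k \<longleftrightarrow> k * i \<le> n" "n div k < Suc i \<longleftrightarrow> n < k * Suc i"
      using assms by (simp_all add: less_eq_div_iff_mult_less_eq div_less_iff_less_mult mult.commute)
    thus ?thesis by auto
  qed
  thus ?case
    using Suc by (auto simp: csize_Suc block_def Suc_diff_le min_def)
qed simp

lemma expec_eq_0:
  assumes "\<And>x. x \<in> set_pmf p \<Longrightarrow> h x = 0"
  shows "expec p h = 0"
  using expec_cong[of p h "\<lambda>_. 0"] assms by simp

context
  fixes a :: real and k :: nat
  assumes a: "a > 0" and k: "k \<ge> 1"
begin

text \<open>A complete block has \<open>k\<close> fixed ends and, after \<open>n\<close> steps, at
  most \<open>n\<close> random ends.\<close>

lemma block_deg_prob_eq_0:
  assumes "k * Suc i \<le> n" "d < k \<or> d > n + k"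
  shows "block_deg_prob a k i d n = 0"
  unfolding block_deg_prob_def
proof (rule expec_eq_0)
  fix G assume G: "G \<in> set_pmf (BO1 a n)"
  have n: "n \<ge> 1" using assms(1) k by (auto simp: Suc_le_eq intro!: Nat.gr0I)
  have "csize (block k) (Suc i) n = k"
    using assms(1) by (simp add: csize_block[OF k])
  with csize_le_deg[OF G a n, of "block k" "Suc i"] deg_le_csize_plus[OF G a n, of "block k" "Suc i"]
  show "of_bool (deg (identify_nodes (block k) G) (Suc i) = d) = (0 :: real)"
    using assms(2) by auto
qed

text \<open>New nodes lie in later blocks, so a complete block receives only random ends and its
  degree rises by at most one per step. The inflow weight is
  \<open>wt a k (d - 1) = wt a k d - 1\<close>.\<close>

lemma block_deg_prob_Suc:
  assumes "k * Suc i \<le> n" "d \<ge> 1"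
  shows "block_deg_prob a k i d (Suc n) = (1 - wt a k d / tot a n) * block_deg_prob a k i d n +
           (wt a k d - 1) / tot a n * block_deg_prob a k i (d - 1) n"
proof -
  let ?D = "\<lambda>G. deg (identify_nodes (block k) G) (Suc i)"
  have n: "n \<ge> 1" using assms(1) k by (auto simp: Suc_le_eq intro!: Nat.gr0I)
  have c: "csize (block k) (Suc i) n = k" "csize (block k) (Suc i) (Suc n) = k"
    using assms(1) by (simp_all add: csize_block[OF k])
  have "Suc i \<le> n div k"
    using assms(1) k by (simp add: less_eq_div_iff_mult_less_eq mult.commute)
  hence b: "block k (Suc n) \<noteq> Suc i" by (simp add: block_def)
  have cp: "class_prob a (block k) n (Suc i) D = wt a k D / tot a n" for D
    by (simp add: class_prob_def c wt_def tot_def mult.commute)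
  have nv: "next_val a (block k) n (Suc i) (\<lambda>D. of_bool (D = d)) D =
      (1 - wt a k d / tot a n) * of_bool (D = d) +
      (wt a k d - 1) / tot a n * of_bool (D = d - 1)" for D
  proof (cases "Suc D = d")
    case True
    hence "wt a k d - 1 = wt a k D" by (auto simp: wt_def)
    thus ?thesis using True b by (auto simp: next_val_def cp)
  qed (use b assms(2) in \<open>auto simp: next_val_def cp\<close>)
  have "block_deg_prob a k i d (Suc n) = expec (BO1 a n) (\<lambda>G. (1 - wt a k d / tot a n) * of_bool (?D G = d) +
      (wt a k d - 1) / tot a n * of_bool (?D G = d - 1))"
    unfolding block_deg_prob_def expec_BO1_Suc[OF a n, where h = "\<lambda>D. of_bool (D = d)"] nv ..
  also have "\<dots> = (1 - wt a k d / tot a n) * block_deg_prob a k i d n +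
           (wt a k d - 1) / tot a n * block_deg_prob a k i (d - 1) n"
    unfolding expec_add[OF finite_set_pmf_BO1[OF a]] block_deg_prob_def by simp
  finally show ?thesis .
qed

text \<open>While the block is the last one, a target in it forces the new node, whose index is at
  least that of the target, into the block as well. So each node of the block brings at most two
  ends.\<close>

lemma deg_new_block_le:
  assumes "G \<in> set_pmf (BO1 a n)" "n \<ge> 1" "n \<le> k * Suc i"
  shows "deg (identify_nodes (block k) G) (Suc i) \<le> 2 * csize (block k) (Suc i) n"
  using assms(1) a assms(2,3)
proof (induction rule: set_pmf_BO1_induct)
  case init
  have "block k (Suc 0) = 1" by (simp add: block_def)
  thus ?case
    using csize_Suc[of "block k" "Suc i" 0] by (simp add: deg_identify_loop)
next
  case (step n G s)
  have "block k (Suc n) = Suc i" if "block k s = Suc i"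
  proof -
    have "(s - 1) div k = i" using that by (simp add: block_def)
    hence "i \<le> n div k" using \<open>s \<in> {1..Suc n}\<close> div_le_mono[of "s - 1" n k] by auto
    moreover have "n div k < Suc i"
      using step.prems k by (simp add: div_less_iff_less_mult mult.commute)
    ultimately show ?thesis by (simp add: block_def)
  qed
  thus ?case
    using step by (auto simp: deg_identify_add_node_edge csize_Suc)
qed

text \<open>A union bound over the steps that fill the block: the degree differs from
  \<open>r\<close> only if a random end has hit the block. Each step does so with probability at
  most \<open>real k * (1 + a) / tot a (k * i)\<close>, because the excess is at most
  \<open>k\<close> and the denominators increase.\<close>

lemma new_block_excess:
  assumes i: "i \<ge> 1" and r: "r \<le> k"
  shows "expec (BO1 a (k * i + r))
      (\<lambda>G. of_bool (deg (identify_nodes (block k) G) (Suc i) \<noteq> r)) \<le>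
    real r * (real k * (1 + a) / tot a (k * i))"
  using r
proof (induction r)
  case 0
  have "k * i \<ge> 1" using mult_le_mono[OF k i] by linarith
  hence "expec (BO1 a (k * i + 0))
      (\<lambda>G. of_bool (deg (identify_nodes (block k) G) (Suc i) \<noteq> 0)) = 0"
    using deg_new_block_le[of _ "k * i" i] by (intro expec_eq_0) (auto simp: csize_block[OF k])
  thus ?case by (simp only: of_nat_0 mult_zero_left)
next
  case (Suc r)
  let ?n = "k * i + r" and ?T = "tot a (k * i)"
  let ?D = "\<lambda>G. deg (identify_nodes (block k) G) (Suc i)"
  have n: "?n \<ge> 1" using mult_le_mono[OF k i] by linarith
  have c: "csize (block k) (Suc i) ?n = r" "csize (block k) (Suc i) (Suc ?n) = Suc r"
    using Suc.prems by (simp_all add: csize_block[OF k])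
  have b: "block k (Suc ?n) = Suc i"
    using Suc.prems by (simp add: block_def)
  have T: "?T > 0" "?T \<le> tot a ?n"
    using tot_pos[OF a k] a by (simp, simp add: tot_def)
  let ?q = "real k * (1 + a) / ?T"
  have "expec (BO1 a (Suc ?n)) (\<lambda>G. of_bool (?D G \<noteq> Suc r)) =
      expec (BO1 a ?n) (\<lambda>G. next_val a (block k) ?n (Suc i) (\<lambda>D. of_bool (D \<noteq> Suc r)) (?D G))"
    by (rule expec_BO1_Suc[OF a n])
  also have "\<dots> \<le> expec (BO1 a ?n) (\<lambda>G. of_bool (?D G \<noteq> r) + ?q)"
  proof (rule expec_mono[OF finite_set_pmf_BO1[OF a]])
    fix G assume G: "G \<in> set_pmf (BO1 a ?n)"
    have lo: "r \<le> ?D G" using csize_le_deg[OF G a n, of "block k" "Suc i"] c by simp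
    have hi: "?D G \<le> 2 * r" using deg_new_block_le[OF G n, of i] c Suc.prems by simp
    let ?p = "class_prob a (block k) ?n (Suc i) (?D G)"
    have p: "?p = (real (?D G) - real r + a * real (Suc r)) / tot a ?n"
      by (simp add: class_prob_def c tot_def)
    have p0: "?p \<ge> 0" unfolding p using lo a T by (intro divide_nonneg_nonneg) auto
    have "real (?D G) - real r + a * real (Suc r) \<le> real k * (1 + a)"
    proof -
      have "real (?D G) - real r \<le> real k" using hi Suc.prems by linarith
      moreover have "a * real (Suc r) \<le> a * real k" using a Suc.prems by (intro mult_left_mono) auto
      ultimately show ?thesis by (simp add: algebra_simps)
    qed
    hence "?p \<le> ?q" unfolding p using a T k by (intro frac_le) auto
    thus "next_val a (block k) ?n (Suc i) (\<lambda>D. of_bool (D \<noteq> Suc r)) (?D G) \<le>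
        of_bool (?D G \<noteq> r) + ?q"
      using p0 b by (auto simp: next_val_def)
  qed
  also have "\<dots> = expec (BO1 a ?n) (\<lambda>G. of_bool (?D G \<noteq> r)) + ?q"
    unfolding expec_add[OF finite_set_pmf_BO1[OF a]] by simp
  also have "\<dots> \<le> real r * ?q + ?q" using Suc by simp
  also have "\<dots> = real (Suc r) * ?q" unfolding of_nat_Suc distrib_right by simp
  finally show ?case by (simp only: add_Suc_right)
qed

text \<open>Step \<open>Suc n\<close> completes the block with index \<open>n div k\<close>, whose
  degree law is the source in the recursion for the mean.\<close>

lemma block_deg_prob_new_block:
  assumes "n \<ge> k" "Suc n mod k = 0"
  shows "\<bar>block_deg_prob a k (n div k) d (Suc n) - of_bool (d = k)\<bar> \<le> 2 * (real k)\<^sup>2 * (1 + a) / tot a n"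
    and "d > 2 * k \<Longrightarrow> block_deg_prob a k (n div k) d (Suc n) = 0"
proof -
  define i where "i = n div k"
  let ?D = "\<lambda>G. deg (identify_nodes (block k) G) (Suc i)"
  have i: "i \<ge> 1" using assms(1) k by (simp add: i_def div_greater_zero_iff Suc_le_eq)
  have "Suc n div k = Suc i" using assms(2) by (simp add: div_Suc i_def)
  hence Sn: "Suc n = k * Suc i" using assms(2) by (metis add.right_neutral mult_div_mod_eq)
  have fin: "finite (set_pmf (BO1 a (Suc n)))" by (rule finite_set_pmf_BO1[OF a])
  have "\<bar>block_deg_prob a k i d (Suc n) - of_bool (d = k)\<bar> =
      \<bar>expec (BO1 a (Suc n)) (\<lambda>G. of_bool (?D G = d) - of_bool (d = k))\<bar>"
    unfolding block_deg_prob_def using fin by (simp add: integrable_measure_pmf_finite)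
  also have "\<dots> \<le> expec (BO1 a (Suc n)) (\<lambda>G. \<bar>of_bool (?D G = d) - of_bool (d = k)\<bar>)"
    by (rule integral_abs_bound)
  also have "\<dots> \<le> expec (BO1 a (Suc n)) (\<lambda>G. of_bool (?D G \<noteq> k))"
    by (rule expec_mono[OF fin]) auto
  also have "\<dots> \<le> real k * (real k * (1 + a) / tot a (k * i))"
    using new_block_excess[OF i, of k] unfolding Sn by (simp add: add.commute)
  also have "\<dots> = 2 * (real k)\<^sup>2 * (1 + a) / (2 * tot a (k * i))"
    by (simp add: power2_eq_square)
  \<comment> \<open>As \<open>i \<ge> 1\<close>, the denominators at the start and at the end of the
    block differ by at most a factor 2.\<close>
  also have "\<dots> \<le> 2 * (real k)\<^sup>2 * (1 + a) / tot a n"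
  proof (rule divide_left_mono)
    have "k \<le> k * i" using i by simp
    hence "Suc n \<le> 2 * (k * i)" unfolding Sn by simp
    hence "real (Suc n) \<le> 2 * real (k * i)" by linarith
    hence "(a + 1) * real (Suc n) \<le> (a + 1) * (2 * real (k * i))"
      using a by (intro mult_left_mono) auto
    thus "tot a n \<le> 2 * tot a (k * i)" using a by (simp add: tot_def algebra_simps)
    show "0 < (2 * tot a (k * i)) * tot a n" using tot_pos[OF a k] by simp
  qed (use a in auto)
  finally show "\<bar>block_deg_prob a k (n div k) d (Suc n) - of_bool (d = k)\<bar> \<le> 2 * (real k)\<^sup>2 * (1 + a) / tot a n"
    by (simp only: i_def)
  show "block_deg_prob a k (n div k) d (Suc n) = 0" if "d > 2 * k"
    unfolding block_deg_prob_def i_def[symmetric]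
  proof (rule expec_eq_0)
    fix G assume "G \<in> set_pmf (BO1 a (Suc n))"
    from deg_new_block_le[OF this, of i] have "?D G \<le> 2 * k"
      unfolding Sn using k by (simp add: csize_block)
    thus "of_bool (?D G = d) = (0 :: real)" using that by simp
  qed
qed

text \<open>\<open>recursion_estimate\<close> is applied to the sum over all complete blocks, at
  \<open>n = k * t\<close>, where \<open>n mod k = 0\<close> removes the sawtooth. Passing from
  \<open>tot a (k * t) / (real k * (a + 1))\<close> to \<open>t\<close> costs at most
  \<open>dens a k d\<close>, which is of order \<open>1 / wt a k d\<close> or smaller.\<close>

lemma expected_count:
  obtains A N where "A \<ge> 0" "\<And>d t. t \<ge> N \<Longrightarrow> d \<ge> k \<Longrightarrow>
    \<bar>(\<Sum>i<t. block_deg_prob a k i d (k * t)) - dens a k d * real t\<bar> \<le> A / wt a k d"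
proof -
  define E where "E d n = (\<Sum>i<n div k. block_deg_prob a k i d n)" for d n
  have full: "k * Suc i \<le> n" if "i < n div k" for i n
    using that k by (simp add: less_eq_div_iff_mult_less_eq Suc_le_eq[symmetric] mult.commute)
  obtain A N where A: "A \<ge> 0" and AN: "\<And>d n. n \<ge> N \<Longrightarrow> d \<ge> k \<Longrightarrow>
    \<bar>E d n - (dens a k d * tot a n / (real k * (a + 1)) -
      of_bool (d = k) * real (n mod k) / real k)\<bar> \<le> A / wt a k d"
  proof (rule recursion_estimate[OF a k, of "2 * (real k)\<^sup>2 * (1 + a)" E
        "\<lambda>d n. block_deg_prob a k (n div k) d (Suc n)"])
    show "E d (Suc n) = (1 - wt a k d / tot a n) * E d n + (wt a k d - 1) / tot a n * E (d - 1) n +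
        (if Suc n mod k = 0 then block_deg_prob a k (n div k) d (Suc n) else 0)"
      if "n \<ge> k" "d \<ge> k" for d n
    proof -
      have "E d (Suc n) = (\<Sum>i<n div k. block_deg_prob a k i d (Suc n)) +
          (if Suc n mod k = 0 then block_deg_prob a k (n div k) d (Suc n) else 0)"
        by (simp add: E_def div_Suc)
      also have "(\<Sum>i<n div k. block_deg_prob a k i d (Suc n)) =
          (\<Sum>i<n div k. (1 - wt a k d / tot a n) * block_deg_prob a k i d n +
            (wt a k d - 1) / tot a n * block_deg_prob a k i (d - 1) n)"
        using that k by (intro sum.cong refl block_deg_prob_Suc full) auto
      finally show ?thesis
        by (simp add: E_def sum.distrib sum_distrib_left)
    qed
    show "E d n = 0" if "n \<ge> k" "d < k \<or> d > n + k" for d n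
      unfolding E_def by (intro sum.neutral ballI block_deg_prob_eq_0 that full) simp
  qed (use a block_deg_prob_new_block in auto)
  obtain B where B: "B > 0" "\<And>d. d \<ge> k \<Longrightarrow> dens a k d * (wt a k d)\<^sup>2 \<le> B"
    using dens_sq_le[OF a k] by blast
  have "\<bar>(\<Sum>i<t. block_deg_prob a k i d (k * t)) - dens a k d * real t\<bar> \<le> (A + B / (real k * a)) / wt a k d"
    if "t \<ge> N" "d \<ge> k" for d t
  proof -
    have w: "wt a k d > 0" "wt a k d \<ge> real k * a" using wt_pos[OF a k] wt_ge[OF a k] that by auto
    have dp: "dens a k d > 0" using dens_pos[OF a k] that by auto
    have "N \<le> k * t" using that k by (metis le_trans mult_le_mono1 mult_1)
    from AN[OF this that(2)] have 1: "\<bar>(\<Sum>i<t. block_deg_prob a k i d (k * t)) -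
        dens a k d * tot a (k * t) / (real k * (a + 1))\<bar> \<le> A / wt a k d"
      using k by (simp add: E_def)
    define c where "c = real k * (a + 1)"
    have "1 * (a + 1) \<le> c" unfolding c_def using a k by (intro mult_right_mono) auto
    hence c: "c > 0" "a \<le> c" using a by auto
    have "tot a (k * t) = c * real t + a" by (simp add: tot_def c_def algebra_simps)
    hence eq: "dens a k d * tot a (k * t) / c - dens a k d * real t = dens a k d * (a / c)"
      using c by (simp add: field_simps)
    also have "\<dots> \<le> dens a k d * 1"
      using dp c by (intro mult_left_mono) auto
    also have "\<dots> = dens a k d * (wt a k d)\<^sup>2 / wt a k d / wt a k d"
      using w by (simp add: power2_eq_square)
    also have "\<dots> \<le> B / (real k * a) / wt a k d"
      using w a k B dp that by (intro divide_right_mono frac_le) auto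
    finally have 2: "dens a k d * tot a (k * t) / c - dens a k d * real t \<le>
        B / (real k * a) / wt a k d" .
    have 3: "dens a k d * tot a (k * t) / c - dens a k d * real t \<ge> 0"
      unfolding eq using dp a c by simp
    show ?thesis using 1[folded c_def] 2 3 unfolding add_divide_distrib by linarith
  qed
  moreover have "A + B / (real k * a) \<ge> 0" using A B a by simp
  ultimately show ?thesis using that by blast
qed

end

subsection \<open>Concentration\<close>

lemma prob_eq_expec: "measure_pmf.prob p {x. Q x} = expec p (\<lambda>x. of_bool (Q x))"
proof -
  have "expec p (\<lambda>x. of_bool (Q x)) = expec p (indicat_real {x. Q x})"
    by (rule expec_cong) (auto simp: indicator_def)
  thus ?thesis by simp
qed

lemma vari_of_bool_le:
  assumes "finite (set_pmf p)"
  shows "vari p (\<lambda>x. of_bool (Q x)) \<le> expec p (\<lambda>x. of_bool (Q x))"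
proof -
  have "expec p (\<lambda>x. (of_bool (Q x))\<^sup>2) = expec p (\<lambda>x. of_bool (Q x))"
    by (rule expec_cong) auto
  thus ?thesis by (simp add: vari_eq[OF assms])
qed

text \<open>
  If \<open>\<delta> \<le> x\<close>, the deviation is controlled by the second moment. If \<open>x < \<delta>\<close>, the mean is \<open>O(\<delta>)\<close>,
  and a deviation forces the count to be nonzero.
\<close>

lemma count_concentration:
  fixes X :: "'a \<Rightarrow> real" and m x \<delta> \<psi> A B :: real
  assumes p: "finite (set_pmf p)"
    and X: "\<And>G. G \<in> set_pmf p \<Longrightarrow> X G = 0 \<or> X G \<ge> 1"
    and V: "vari p X \<le> 2 * expec p X"
    and E: "\<bar>expec p X - m\<bar> \<le> A * \<delta>" and m: "0 \<le> m" "m \<le> B * x"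
    and x: "x > 0" and \<delta>: "0 < \<delta>" "\<delta> \<le> 1"
    and \<psi>: "\<psi> > 0" "\<psi> \<ge> B" and A: "A \<ge> 0" and B: "B \<ge> 0"
  shows "measure_pmf.prob p {G. \<not> \<bar>X G - m\<bar> \<le> (sqrt x + \<delta>) * \<psi>} \<le>
    (2 * B + 2 * A + A\<^sup>2) / \<psi>\<^sup>2 + (if x < \<delta> then (A + B) * \<delta> else 0)"
proof (cases "x < \<delta>")
  case True
  have "measure_pmf.prob p {G. \<not> \<bar>X G - m\<bar> \<le> (sqrt x + \<delta>) * \<psi>} \<le> expec p X"
    unfolding prob_eq_expec
  proof (rule expec_mono[OF p])
    fix G assume "G \<in> set_pmf p"
    note X = X[OF this]
    \<comment> \<open>As \<open>x < \<delta> \<le> 1\<close>, the value \<open>m\<close> lies within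
      the permitted deviation, so a count of 0 is never bad and a bad count is at least 1.\<close>
    have "x \<le> sqrt x"
      using x True \<delta> by (intro real_le_rsqrt) (auto simp: power2_eq_square mult_left_le)
    hence "m \<le> B * sqrt x" using m B by (meson mult_left_mono order_trans)
    also have "\<dots> \<le> (sqrt x + \<delta>) * \<psi>"
      using \<psi> x \<delta> B mult_mono[of B \<psi> "sqrt x" "sqrt x + \<delta>"] by (simp add: mult.commute)
    finally show "of_bool (\<not> \<bar>X G - m\<bar> \<le> (sqrt x + \<delta>) * \<psi>) \<le> X G"
      using X m by auto
  qed
  also have "\<dots> \<le> m + A * \<delta>" using E by linarith
  also have "m \<le> B * \<delta>" using m True B by (meson less_imp_le mult_left_mono order_trans)
  finally have "measure_pmf.prob p {G. \<not> \<bar>X G - m\<bar> \<le> (sqrt x + \<delta>) * \<psi>} \<le> (A + B) * \<delta>"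
    by (simp add: algebra_simps)
  moreover have "0 \<le> (2 * B + 2 * A + A\<^sup>2) / \<psi>\<^sup>2" using A B by simp
  ultimately show ?thesis using True by simp
next
  case False
  have "measure_pmf.prob p {G. \<not> \<bar>X G - m\<bar> \<le> (sqrt x + \<delta>) * \<psi>} \<le>
      expec p (\<lambda>G. (X G - m)\<^sup>2 / (x * \<psi>\<^sup>2))"
    unfolding prob_eq_expec
  proof (rule expec_mono[OF p])
    fix G
    show "of_bool (\<not> \<bar>X G - m\<bar> \<le> (sqrt x + \<delta>) * \<psi>) \<le> (X G - m)\<^sup>2 / (x * \<psi>\<^sup>2)"
    proof (cases "\<bar>X G - m\<bar> \<le> (sqrt x + \<delta>) * \<psi>")
      case False
      moreover have "sqrt x * \<psi> \<le> (sqrt x + \<delta>) * \<psi>"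
        using \<delta> \<psi> by (intro mult_right_mono) auto
      ultimately have "sqrt x * \<psi> \<le> \<bar>X G - m\<bar>" by linarith
      hence "(sqrt x * \<psi>)\<^sup>2 \<le> \<bar>X G - m\<bar>\<^sup>2" using x \<psi> by (intro power_mono) auto
      hence "x * \<psi>\<^sup>2 \<le> (X G - m)\<^sup>2" using x by (simp add: power_mult_distrib)
      thus ?thesis using False x \<psi> by simp
    qed (use x in simp)
  qed
  also have "\<dots> = expec p (\<lambda>G. (X G - m)\<^sup>2) / (x * \<psi>\<^sup>2)"
    by simp
  \<comment> \<open>The second moment about \<open>m\<close> is the variance plus the squared bias.
    Both are of order \<open>x\<close>, because
    \<open>\<delta>\<^sup>2 \<le> \<delta> \<le> x\<close>.\<close>
  also have "expec p (\<lambda>G. (X G - m)\<^sup>2) = vari p X + (expec p X - m)\<^sup>2"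
    using p by (simp add: vari_eq integrable_measure_pmf_finite power2_diff)
       (simp add: power2_eq_square)
  also have "vari p X + (expec p X - m)\<^sup>2 \<le> (2 * B + 2 * A + A\<^sup>2) * x"
  proof -
    have "A * \<delta> \<le> A * x" using False A by (intro mult_left_mono) auto
    moreover have "expec p X \<le> m + A * \<delta>" using E by linarith
    ultimately have "vari p X \<le> (2 * B + 2 * A) * x" using V m by (simp add: algebra_simps)
    moreover have "(expec p X - m)\<^sup>2 \<le> (A * \<delta>)\<^sup>2"
      using E by (metis abs_ge_zero power2_abs power_mono)
    moreover have "\<delta>\<^sup>2 \<le> x"
      using \<delta> False mult_left_le[of \<delta> \<delta>] unfolding power2_eq_square by linarith
    hence "(A * \<delta>)\<^sup>2 \<le> A\<^sup>2 * x" unfolding power_mult_distrib by (intro mult_left_mono) auto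
    ultimately show ?thesis by (simp add: algebra_simps)
  qed
  hence "(vari p X + (expec p X - m)\<^sup>2) / (x * \<psi>\<^sup>2) \<le> (2 * B + 2 * A + A\<^sup>2) * x / (x * \<psi>\<^sup>2)"
    using x by (intro divide_right_mono) auto
  also have "\<dots> = (2 * B + 2 * A + A\<^sup>2) / \<psi>\<^sup>2" using x by simp
  finally show ?thesis using False by simp
qed

lemma num_nodes_of_degree_block:
  assumes "a > 0" "k \<ge> 1" "t \<ge> 1" "G \<in> set_pmf (BO1 a (k * t))"
  shows "real (num_nodes_of_degree d (identify_nodes (block k) G)) =
    (\<Sum>i<t. of_bool (deg (identify_nodes (block k) G) (Suc i) = d))"
proof -
  have "k * t \<ge> 1" using mult_le_mono[OF assms(2,3)] by linarith
  hence "nodes G = {1..k * t}" using nodes_BO1[OF assms(4,1)] by simp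
  moreover have "block k ` {1..k * t} = Suc ` {..<t}"
  proof (intro equalityI subsetI)
    fix j assume "j \<in> block k ` {1..k * t}"
    then obtain v where v: "v \<in> {1..k * t}" "j = Suc ((v - 1) div k)"
      by (auto simp: block_def)
    hence "(v - 1) div k < t" using assms(2)
      by (simp add: div_less_iff_less_mult mult.commute) linarith
    thus "j \<in> Suc ` {..<t}" using v by simp
  next
    fix j assume "j \<in> Suc ` {..<t}"
    then obtain i where i: "i < t" "j = Suc i" by auto
    have "Suc (k * i) \<le> k * t" using i assms(2) by (intro Suc_leI) simp
    moreover have "block k (Suc (k * i)) = j" using i assms(2) by (simp add: block_def)
    ultimately show "j \<in> block k ` {1..k * t}" by (intro image_eqI[of _ _ "Suc (k * i)"]) auto
  qed
  ultimately have "nodes (identify_nodes (block k) G) = Suc ` {..<t}"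
    by (simp add: identify_nodes_def)
  hence "{v \<in> nodes (identify_nodes (block k) G). deg (identify_nodes (block k) G) v = d} =
      Suc ` {i \<in> {..<t}. deg (identify_nodes (block k) G) (Suc i) = d}"
    by auto
  hence "num_nodes_of_degree d (identify_nodes (block k) G) =
      card {i \<in> {..<t}. deg (identify_nodes (block k) G) (Suc i) = d}"
    by (simp add: num_nodes_of_degree_def card_image)
  thus ?thesis by (simp add: Int_def)
qed

theorem corollary1:
  fixes a :: real and k :: nat and d :: "nat \<Rightarrow> nat" and \<psi> :: "nat \<Rightarrow> real"
  assumes "a > 0"
    and "k \<ge> 1"
    and "\<And>t. d t \<ge> k"
    and "filterlim \<psi> at_top sequentially"
  shows "(\<lambda>t. measure_pmf.prob (BO a k t)
            {G. \<bar>real (num_nodes_of_degree (d t) G)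
                  - Beta (real (d t) - real k + real k * a) (a + 2) / Beta (real k * a) (a + 1) * real t\<bar>
                \<le> (sqrt (real (d t) powr (- a - 2) * real t) + 1 / real (d t)) * \<psi> t})
         \<longlonglongrightarrow> 1"
proof -
  note a = \<open>a > 0\<close> and k = \<open>k \<ge> 1\<close>
  obtain A N where A: "A \<ge> 0" and AN: "\<And>d t. t \<ge> N \<Longrightarrow> d \<ge> k \<Longrightarrow>
    \<bar>(\<Sum>i<t. block_deg_prob a k i d (k * t)) - dens a k d * real t\<bar> \<le> A / wt a k d"
    using expected_count[OF a k] by blast
  obtain B where B: "B > 0" "\<And>d. d \<ge> k \<Longrightarrow> dens a k d \<le> B * wt a k d powr (- a - 2)"
    using dens_le[OF a k] by blast
  \<comment> \<open>With this choice \<open>c * d \<le> wt a k d\<close> for all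
    \<open>d \<ge> k\<close>, which turns estimates in \<open>wt\<close> into estimates in
    \<open>d\<close>.\<close>
  define c where "c = min 1 a"
  have c: "c > 0" using a by (simp add: c_def)
  define A1 where "A1 = A / c"
  define B1 where "B1 = B * c powr (- a - 2)"
  define K where "K = 2 * B1 + 2 * A1 + A1\<^sup>2"
  have A1: "A1 \<ge> 0" using A c by (simp add: A1_def)
  have B1: "B1 \<ge> 0" using B by (simp add: B1_def)
  define good where "good t G \<longleftrightarrow> \<bar>real (num_nodes_of_degree (d t) G) - dens a k (d t) * real t\<bar>
      \<le> (sqrt (real (d t) powr (- a - 2) * real t) + 1 / real (d t)) * \<psi> t" for t and G :: "nat multigraph"
  \<comment> \<open>The lower bound does not involve \<open>d t\<close>, so \<open>d\<close> may
    vary with \<open>t\<close> in any way. The condition on \<open>\<psi>\<close> ensures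
    \<open>\<psi> t > 0\<close> and \<open>\<psi> t \<ge> B1\<close>.\<close>
  have bound: "1 - (K / (\<psi> t)\<^sup>2 + (A1 + B1) * real t powr (- 1 / (a + 1))) \<le>
      measure_pmf.prob (BO a k t) {G. good t G}"
    if t: "t \<ge> max N 1" and \<psi>: "\<psi> t \<ge> B1 + 1" for t
  proof -
    let ?D = "real (d t)" and ?deg = "\<lambda>G. deg (identify_nodes (block k) G)"
    define p where "p = BO1 a (k * t)"
    define x where "x = ?D powr (- a - 2) * real t"
    define X where "X G = (\<Sum>i<t. of_bool (?deg G (Suc i) = d t) :: real)" for G
    have kd: "k \<le> d t" by (rule assms(3))
    have D: "?D \<ge> 1" using kd k by linarith
    have w: "c * ?D \<le> wt a k (d t)"
    proof -
      have "c * (?D - real k) \<le> 1 * (?D - real k)" "c * real k \<le> a * real k"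
        using kd by (intro mult_right_mono; simp add: c_def)+
      thus ?thesis by (simp add: wt_def algebra_simps)
    qed
    have p: "finite (set_pmf p)" unfolding p_def by (rule finite_set_pmf_BO1[OF a])
    have kt: "k * t \<ge> 1" using mult_le_mono[OF k, of 1 t] t by simp
    have x: "x > 0" using D t by (simp add: x_def)
    have EX: "expec p X = (\<Sum>i<t. block_deg_prob a k i (d t) (k * t))"
      unfolding X_def expec_sum[OF p] by (simp add: block_deg_prob_def p_def)
    have "vari p X \<le> 2 * (\<Sum>i<t. expec p (\<lambda>G. of_bool (?deg G (Suc i) = d t)))"
    proof -
      have X_Suc: "X G = (\<Sum>j\<in>Suc ` {..<t}. of_bool (?deg G j = d t))" for G
        unfolding X_def by (subst sum.reindex) (auto simp: comp_def)
      have "vari p X \<le> 2 * (\<Sum>j\<in>Suc ` {..<t}. vari p (\<lambda>G. of_bool (?deg G j = d t)))"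
        unfolding X_Suc p_def
        by (rule vari_sum_le[OF a kt, where h = "\<lambda>_ D. of_bool (D = d t)"]) simp
      also have "\<dots> \<le> 2 * (\<Sum>j\<in>Suc ` {..<t}. expec p (\<lambda>G. of_bool (?deg G j = d t)))"
        by (intro mult_left_mono sum_mono vari_of_bool_le p) simp
      finally show ?thesis by (simp add: sum.reindex)
    qed
    also have "\<dots> = 2 * expec p X" unfolding EX unfolding block_deg_prob_def p_def ..
    finally have VX: "vari p X \<le> 2 * expec p X" .
    have X01: "X G = 0 \<or> X G \<ge> 1" for G
    proof -
      obtain m :: nat where "X G = real m"
        by (rule that[of "\<Sum>i<t. of_bool (deg (identify_nodes (block k) G) (Suc i) = d t)"])
           (simp add: X_def)
      thus ?thesis by (cases m) auto
    qed
    have bias: "\<bar>expec p X - dens a k (d t) * real t\<bar> \<le> A1 * (1 / ?D)"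
    proof -
      have "\<bar>expec p X - dens a k (d t) * real t\<bar> \<le> A / wt a k (d t)"
        unfolding EX using t kd by (intro AN) auto
      also have "\<dots> \<le> A / (c * ?D)" using A w c D wt_pos[OF a k kd] by (intro divide_left_mono mult_pos_pos) auto
      finally show ?thesis by (simp add: A1_def)
    qed
    have mB: "dens a k (d t) * real t \<le> B1 * x"
    proof -
      have "dens a k (d t) \<le> B * wt a k (d t) powr (- a - 2)" by (rule B(2)[OF kd])
      also have "\<dots> \<le> B * (c * ?D) powr (- a - 2)"
        using B w c D a by (intro mult_left_mono powr_mono2') auto
      also have "\<dots> = B1 * ?D powr (- a - 2)"
        using c D by (simp add: B1_def powr_mult)
      finally have "dens a k (d t) * real t \<le> B1 * ?D powr (- a - 2) * real t"
        by (rule mult_right_mono) simp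
      thus ?thesis by (simp add: x_def mult.assoc)
    qed
    \<comment> \<open>\<open>x < 1 / ?D\<close> means \<open>t < ?D powr (a + 1)\<close>, so in this
      case the degree exceeds a fixed power of \<open>t\<close>.\<close>
    have small: "1 / ?D \<le> real t powr (- 1 / (a + 1))" if "x < 1 / ?D"
    proof -
      have "?D powr (a + 2) * x = real t"
        using D by (simp add: x_def mult.assoc[symmetric] powr_add[symmetric])
      moreover have "?D powr (a + 2) * (1 / ?D) = ?D powr (a + 1)"
        using D powr_add[of ?D "a + 1" 1] by (simp add: add.assoc)
      moreover have "?D powr (a + 2) * x \<le> ?D powr (a + 2) * (1 / ?D)"
        using that by (intro mult_left_mono) auto
      ultimately have "real t \<le> ?D powr (a + 1)" by simp
      hence "(?D powr (a + 1)) powr (- 1 / (a + 1)) \<le> real t powr (- 1 / (a + 1))"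
        using t a by (intro powr_mono2') auto
      moreover have "(?D powr (a + 1)) powr (- 1 / (a + 1)) = 1 / ?D"
        using a D by (simp add: powr_powr powr_minus_divide)
      ultimately show ?thesis by simp
    qed
    let ?bad = "{G. \<not> \<bar>X G - dens a k (d t) * real t\<bar> \<le> (sqrt x + 1 / ?D) * \<psi> t}"
    have "measure_pmf.prob p ?bad \<le> K / (\<psi> t)\<^sup>2 + (if x < 1 / ?D then (A1 + B1) * (1 / ?D) else 0)"
      unfolding K_def using x D A1 B1 \<psi> dens_pos[OF a k kd] t
      by (intro count_concentration[OF p X01 VX bias _ mB]) auto
    also have "\<dots> \<le> K / (\<psi> t)\<^sup>2 + (A1 + B1) * real t powr (- 1 / (a + 1))"
    proof (cases "x < 1 / ?D")
      case True
      have "(A1 + B1) * (1 / ?D) \<le> (A1 + B1) * real t powr (- 1 / (a + 1))"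
        using small[OF True] A1 B1 by (intro mult_left_mono) auto
      thus ?thesis using True by simp
    qed (use A1 B1 in simp)
    finally have bad: "measure_pmf.prob p ?bad \<le> \<dots>" .
    have "measure_pmf.prob (BO a k t) {G. good t G} =
        measure_pmf.prob p {G. good t (identify_nodes (block k) G)}"
      by (simp add: BO_def p_def block_def[abs_def] vimage_def)
    also have "\<dots> = measure_pmf.prob p {G. \<bar>X G - dens a k (d t) * real t\<bar> \<le> (sqrt x + 1 / ?D) * \<psi> t}"
      unfolding prob_eq_expec using t
      by (intro expec_cong) (auto simp: good_def p_def X_def x_def num_nodes_of_degree_block[OF a k])
    also have "\<dots> = 1 - measure_pmf.prob p ?bad"
    proof -
      have "{G. \<bar>X G - dens a k (d t) * real t\<bar> \<le> (sqrt x + 1 / ?D) * \<psi> t} = space p - ?bad"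
        by auto
      thus ?thesis using measure_pmf.prob_compl[of ?bad p] by (simp only: sets_measure_pmf UNIV_I)
    qed
    finally show ?thesis using bad by linarith
  qed
  have "((\<lambda>t. K / (\<psi> t)\<^sup>2 + (A1 + B1) * real t powr (- 1 / (a + 1))) \<longlongrightarrow> 0 + (A1 + B1) * 0) sequentially"
  proof (intro tendsto_add tendsto_mult tendsto_const)
    show "(\<lambda>t. K / (\<psi> t)\<^sup>2) \<longlonglongrightarrow> 0"
      by (intro tendsto_divide_0[OF tendsto_const] filterlim_at_top_imp_at_infinity
          filterlim_pow_at_top assms(4)) simp
    show "(\<lambda>t. real t powr (- 1 / (a + 1))) \<longlonglongrightarrow> 0"
      using a by (intro tendsto_neg_powr filterlim_real_sequentially) auto
  qed
  hence lim: "(\<lambda>t. 1 - (K / (\<psi> t)\<^sup>2 + (A1 + B1) * real t powr (- 1 / (a + 1)))) \<longlonglongrightarrow> 1"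
    by (auto dest: tendsto_diff[OF tendsto_const[of 1]])
  have "eventually (\<lambda>t. \<psi> t \<ge> B1 + 1) sequentially"
    using assms(4) by (simp add: filterlim_at_top)
  hence ev: "eventually (\<lambda>t. 1 - (K / (\<psi> t)\<^sup>2 + (A1 + B1) * real t powr (- 1 / (a + 1))) \<le>
      measure_pmf.prob (BO a k t) {G. good t G}) sequentially"
    using eventually_ge_at_top[of "max N 1"] by eventually_elim (rule bound)
  have "(\<lambda>t. measure_pmf.prob (BO a k t) {G. good t G}) \<longlonglongrightarrow> 1"
    by (rule tendsto_sandwich[OF ev _ lim tendsto_const]) simp
  thus ?thesis by (simp only: good_def dens_def wt_def)
qed

end
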